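(* Let $M$ be a smooth, connected, compact $n$-dimensional manifold with a connection on its frame bundle $\pi:FM\to M$, with horizontal bundle $\mathcal{H}\subset TFM$. Let $q:\mathrm{Sym}^+M\to M$ be the bundle of symmetric positive definite covariant 2-tensors on $M$ and let $\Sigma:FM\to\mathrm{Sym}^+M$ be the map $\Sigma(u)(v,w)=\langle u^{-1}(v),u^{-1}(w)\rangle_{\mathbb{R}^n}$, $v,w\in T_{\pi(u)}M$. Then there is a smooth splitting $T\,\mathrm{Sym}^+M\cong\mathcal{H}^S\oplus\ker q_*$ such that $\Sigma_*\mathcal{H}=\mathcal{H}^S$. In particular, for every $\sigma\in\mathrm{Sym}^+M$, any vector $v\in T_{q(\sigma)}M$ has a unique horizontal lift to $\mathcal{H}^S_\sigma$, denoted $h^S_\sigma(v)$, i.e. a unique vector $h^S_\sigma(v)\in\mathcal{H}^S_\sigma$ with $q_*h^S_\sigma(v)=v$.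
   Context: $FM$ is the principal $\mathrm{GL}(n)$-bundle whose points over $x\in M$ are linear isomorphisms $u:\mathbb{R}^n\to T_xM$. A connection on $FM$ is a smooth splitting $TFM\cong\mathcal{V}\oplus\mathcal{H}$, where $\mathcal{V}=\ker\pi_*$ is the vertical bundle and $\mathcal{H}$ is any complement, called the horizontal bundle. A point of $\mathrm{Sym}^+M$ over $x$ is an inner product on $T_xM$; one has $\pi=q\circ\Sigma$.
   Formalization: The connection on the frame bundle is taken to be a principal connection, i.e. the horizontal bundle is assumed invariant under the right GL(n)-action; for arbitrary complements the claim fails (e.g. M a circle, H spanned by d/dx + d/du). The dimension n is at least 1. *)

theory Defs
  imports
    "HOL-Analysis.Analysis"
    "HOL-Library.Function_Algebras"
    "HOL-Library.Uprod"
begin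

text \<open>
  A tangent vector is represented by the family of its components in all charts around its
  base point (see \<open>tangent_space\<close>), hence by a function. The pointwise vector space structure on
  functions makes \<^const>\<open>subspace\<close>, \<^const>\<open>span\<close> and \<^const>\<open>linear\<close> available for tangent spaces.
\<close>

instantiation "fun" :: (type, real_vector) real_vector
begin

definition scaleR_fun :: "real \<Rightarrow> ('a \<Rightarrow> 'b) \<Rightarrow> 'a \<Rightarrow> 'b"
  where "scaleR_fun r f = (\<lambda>x. r *\<^sub>R f x)"

instance
  by standard (auto simp: scaleR_fun_def plus_fun_def fun_eq_iff scaleR_add_right scaleR_add_left)

end

instance uprod :: (finite) finite
proof
  have "(UNIV :: 'a uprod set) \<subseteq> range (\<lambda>(a, b). Upair a b)"
  proof
    fix z :: "'a uprod"
    show "z \<in> range (\<lambda>(a, b). Upair a b)" by (cases z) auto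
  qed
  then show "finite (UNIV :: 'a uprod set)"
    by (rule finite_subset) simp
qed


section \<open>Smooth manifolds\<close>

text \<open>\<open>C\<^sup>k\<close> maps, meant for open \<open>S\<close>: all iterated directional derivatives up to order \<open>k\<close>
  exist and are continuous.\<close>

primrec C_k_on ::
  "nat \<Rightarrow> 'e::real_normed_vector set \<Rightarrow> ('e \<Rightarrow> 'f::real_normed_vector) \<Rightarrow> bool"
where
  "C_k_on 0 S f \<longleftrightarrow> continuous_on S f"
| "C_k_on (Suc k) S f \<longleftrightarrow>
     (\<forall>x\<in>S. f differentiable (at x)) \<and> (\<forall>v. C_k_on k S (\<lambda>x. frechet_derivative f (at x) v))"

definition smooth_on ::
  "'e::real_normed_vector set \<Rightarrow> ('e \<Rightarrow> 'f::real_normed_vector) \<Rightarrow> bool"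
where "smooth_on S f \<longleftrightarrow> (\<forall>k. C_k_on k S f)"

text \<open>A chart \<open>(U, \<phi>)\<close> consists of its domain and the coordinate map, whose values outside \<open>U\<close>
  are irrelevant. A manifold is given by a smooth atlas; its points are those covered by
  the atlas and its topology is the one for which all charts are homeomorphisms onto open sets.\<close>

type_synonym ('a, 'e) chart = "'a set \<times> ('a \<Rightarrow> 'e)"
type_synonym ('a, 'e) tangent = "('a, 'e) chart \<Rightarrow> 'e"

abbreviation chart_dom :: "('a, 'e) chart \<Rightarrow> 'a set"
  where "chart_dom \<equiv> fst"

abbreviation chart_map :: "('a, 'e) chart \<Rightarrow> 'a \<Rightarrow> 'e"
  where "chart_map \<equiv> snd"

definition chart_inv :: "('a, 'e) chart \<Rightarrow> 'e \<Rightarrow> 'a"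
  where "chart_inv c = inv_into (chart_dom c) (chart_map c)"

definition points :: "('a, 'e) chart set \<Rightarrow> 'a set"
  where "points A = (\<Union>c\<in>A. chart_dom c)"

definition charts_at :: "('a, 'e) chart set \<Rightarrow> 'a \<Rightarrow> ('a, 'e) chart set"
  where "charts_at A p = {c \<in> A. p \<in> chart_dom c}"

definition transition :: "('a, 'e) chart \<Rightarrow> ('a, 'e) chart \<Rightarrow> 'e \<Rightarrow> 'e"
  where "transition c d = (\<lambda>y. chart_map d (chart_inv c y))"

definition smooth_atlas :: "('a, 'e::euclidean_space) chart set \<Rightarrow> bool"
where
  "smooth_atlas A \<longleftrightarrow>
     (\<forall>c\<in>A. inj_on (chart_map c) (chart_dom c) \<and> open (chart_map c ` chart_dom c)) \<and>
     (\<forall>c\<in>A. \<forall>d\<in>A. open (chart_map c ` (chart_dom c \<inter> chart_dom d)) \<and>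
        smooth_on (chart_map c ` (chart_dom c \<inter> chart_dom d)) (transition c d))"

definition atlas_topology :: "('a, 'e::euclidean_space) chart set \<Rightarrow> 'a topology"
where
  "atlas_topology A =
     topology (\<lambda>W. W \<subseteq> points A \<and> (\<forall>c\<in>A. open (chart_map c ` (W \<inter> chart_dom c))))"

lemma openin_atlas_topology:
  assumes "smooth_atlas A"
  shows "openin (atlas_topology A) W \<longleftrightarrow>
    W \<subseteq> points A \<and> (\<forall>c\<in>A. open (chart_map c ` (W \<inter> chart_dom c)))"
proof -
  let ?L = "\<lambda>W. W \<subseteq> points A \<and> (\<forall>c\<in>A. open (chart_map c ` (W \<inter> chart_dom c)))"
  have inj: "inj_on (chart_map c) (chart_dom c)" if "c \<in> A" for c
    using assms that by (auto simp: smooth_atlas_def)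
  have "istopology ?L"
    unfolding istopology_def
  proof (intro conjI allI impI)
    fix S T assume S: "?L S" and T: "?L T"
    show "S \<inter> T \<subseteq> points A" using S by blast
    show "\<forall>c\<in>A. open (chart_map c ` (S \<inter> T \<inter> chart_dom c))"
    proof
      fix c assume c: "c \<in> A"
      have "chart_map c ` (S \<inter> T \<inter> chart_dom c) =
        chart_map c ` (S \<inter> chart_dom c) \<inter> chart_map c ` (T \<inter> chart_dom c)"
        using inj[OF c] by (auto simp: inj_on_def)
      then show "open (chart_map c ` (S \<inter> T \<inter> chart_dom c))"
        using S T c by auto
    qed
  next
    fix K assume K: "\<forall>S\<in>K. ?L S"
    then show "\<Union>K \<subseteq> points A" by blast
    show "\<forall>c\<in>A. open (chart_map c ` (\<Union>K \<inter> chart_dom c))"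
    proof
      fix c assume c: "c \<in> A"
      have "chart_map c ` (\<Union>K \<inter> chart_dom c) = (\<Union>S\<in>K. chart_map c ` (S \<inter> chart_dom c))"
        by blast
      then show "open (chart_map c ` (\<Union>K \<inter> chart_dom c))"
        using K c by auto
    qed
  qed
  then show ?thesis
    by (simp add: atlas_topology_def topology_inverse')
qed

definition smooth_manifold :: "('a, 'e::euclidean_space) chart set \<Rightarrow> bool"
where
  "smooth_manifold A \<longleftrightarrow>
     smooth_atlas A \<and>
     Hausdorff_space (atlas_topology A) \<and> second_countable (atlas_topology A)"


section \<open>Tangent bundles and smooth splittings\<close>

text \<open>A tangent vector at \<open>p\<close> assigns to every chart around \<open>p\<close> a vector of the model space,
  such that the assigned vectors transform by the derivatives of the coordinate changes.\<close>

definition tangent_space ::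
  "('a, 'e::euclidean_space) chart set \<Rightarrow> 'a \<Rightarrow> ('a, 'e) tangent set"
where
  "tangent_space A p =
     {v. (\<forall>c. c \<notin> charts_at A p \<longrightarrow> v c = 0) \<and>
         (\<forall>c\<in>charts_at A p. \<forall>d\<in>charts_at A p.
            v d = frechet_derivative (transition c d) (at (chart_map c p)) (v c))}"

definition tangent_bundle ::
  "('a, 'e::euclidean_space) chart set \<Rightarrow> ('a \<times> ('a, 'e) tangent) set"
where "tangent_bundle A = Sigma (points A) (tangent_space A)"

text \<open>The tangent vector at \<open>p\<close> whose component in the chart \<open>c\<close> is \<open>e\<close>.\<close>

definition coord_vector ::
  "('a, 'e::euclidean_space) chart set \<Rightarrow> ('a, 'e) chart \<Rightarrow> 'a \<Rightarrow> 'e \<Rightarrow> ('a, 'e) tangent"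
where
  "coord_vector A c p e =
     (\<lambda>d. if d \<in> charts_at A p
          then frechet_derivative (transition c d) (at (chart_map c p)) e else 0)"

text \<open>The differential \<open>f\<^sub>*\<close> as a map of tangent bundles. By the chain rule the result does not
  depend on the chosen chart \<open>c\<close> around \<open>p\<close> if \<open>f\<close> is smooth.\<close>

definition tangent_map ::
  "('a, 'e::euclidean_space) chart set \<Rightarrow> ('b, 'f::euclidean_space) chart set \<Rightarrow> ('a \<Rightarrow> 'b) \<Rightarrow>
   'a \<times> ('a, 'e) tangent \<Rightarrow> 'b \<times> ('b, 'f) tangent"
where
  "tangent_map A B f = (\<lambda>(p, v).
     (f p,
      let c = (SOME c. c \<in> charts_at A p) in
        (\<lambda>d. if d \<in> charts_at B (f p)
            then frechet_derivative (\<lambda>y. chart_map d (f (chart_inv c y)))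
                   (at (chart_map c p)) (v c)
            else 0)))"

definition smooth_vector_field_on ::
  "('a, 'e::euclidean_space) chart set \<Rightarrow> 'a set \<Rightarrow> ('a \<Rightarrow> ('a, 'e) tangent) \<Rightarrow> bool"
where
  "smooth_vector_field_on A W X \<longleftrightarrow>
     (\<forall>p\<in>W. X p \<in> tangent_space A p) \<and>
     (\<forall>c\<in>A. smooth_on (chart_map c ` (W \<inter> chart_dom c)) (\<lambda>y. X (chart_inv c y) c))"

text \<open>The fibre over \<open>p\<close> of a subset \<open>D\<close> of the tangent bundle is \<open>D `` {p}\<close>. It is a smooth
  subbundle if it is locally spanned by pointwise linearly independent smooth vector fields.\<close>

definition smooth_subbundle ::
  "('a, 'e::euclidean_space) chart set \<Rightarrow> ('a \<times> ('a, 'e) tangent) set \<Rightarrow> bool"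
where
  "smooth_subbundle A D \<longleftrightarrow>
     D \<subseteq> tangent_bundle A \<and>
     (\<forall>p\<in>points A. \<exists>W (k::nat) X.
        openin (atlas_topology A) W \<and> p \<in> W \<and>
        (\<forall>i<k. smooth_vector_field_on A W (X i)) \<and>
        (\<forall>q\<in>W. inj_on (\<lambda>i. X i q) {..<k} \<and> independent ((\<lambda>i. X i q) ` {..<k}) \<and>
               span ((\<lambda>i. X i q) ` {..<k}) = D `` {q}))"

definition smooth_splitting ::
  "('a, 'e::euclidean_space) chart set \<Rightarrow>
   ('a \<times> ('a, 'e) tangent) set \<Rightarrow> ('a \<times> ('a, 'e) tangent) set \<Rightarrow> bool"
where
  "smooth_splitting A D E \<longleftrightarrow>
     smooth_subbundle A D \<and> smooth_subbundle A E \<and>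
     (\<forall>p\<in>points A. D `` {p} \<inter> E `` {p} = {0} \<and>
        {v + w | v w. v \<in> D `` {p} \<and> w \<in> E `` {p}} = tangent_space A p)"

definition kernel_bundle ::
  "('a, 'e::euclidean_space) chart set \<Rightarrow> ('b, 'f::euclidean_space) chart set \<Rightarrow> ('a \<Rightarrow> 'b) \<Rightarrow>
   ('a \<times> ('a, 'e) tangent) set"
where
  "kernel_bundle A B f = {\<xi> \<in> tangent_bundle A. snd (tangent_map A B f \<xi>) = 0}"


section \<open>The frame bundle and connections\<close>

type_synonym ('a, 'n) frame = "'a \<times> (real ^ 'n \<Rightarrow> ('a, real ^ 'n) tangent)"
type_synonym ('a, 'n) frame_chart = "(('a, 'n) frame, (real ^ 'n) \<times> (real ^ 'n ^ 'n)) chart"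

definition frame_bundle :: "('a, real ^ 'n::finite) chart set \<Rightarrow> ('a, 'n) frame set"
where
  "frame_bundle A =
     {(x, u). x \<in> points A \<and> linear u \<and> bij_betw u UNIV (tangent_space A x)}"

text \<open>The coordinates of a frame \<open>(x, u)\<close> are those of \<open>x\<close> and the matrix of \<open>u\<close>
  with respect to the coordinate basis of the tangent space.\<close>

definition frame_bundle_chart ::
  "('a, real ^ 'n::finite) chart set \<Rightarrow> ('a, real ^ 'n) chart \<Rightarrow> ('a, 'n) frame_chart"
where
  "frame_bundle_chart A c =
     ({(x, u) \<in> frame_bundle A. x \<in> chart_dom c},
      \<lambda>(x, u). (chart_map c x, matrix (\<lambda>e. u e c)))"

definition frame_bundle_atlas ::
  "('a, real ^ 'n::finite) chart set \<Rightarrow> ('a, 'n) frame_chart set"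
where "frame_bundle_atlas A = frame_bundle_chart A ` A"

definition right_action :: "real ^ 'n ^ 'n \<Rightarrow> ('a, 'n::finite) frame \<Rightarrow> ('a, 'n) frame"
where "right_action a = (\<lambda>(x, u). (x, \<lambda>e. u (a *v e)))"

text \<open>A connection on the principal bundle of frames, given by its horizontal bundle \<open>H\<close>: a smooth
  complement of the vertical bundle which is invariant under the structure group \<open>GL(n)\<close>.
  Without invariance the image of \<open>H\<close> in the tangent bundle of the bundle of inner products would
  in general not be a vector bundle.\<close>

definition frame_bundle_connection ::
  "('a, real ^ 'n::finite) chart set \<Rightarrow>
   (('a, 'n) frame \<times> (('a, 'n) frame, (real ^ 'n) \<times> (real ^ 'n ^ 'n)) tangent) set \<Rightarrow> bool"
where
  "frame_bundle_connection A H \<longleftrightarrow>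
     smooth_splitting (frame_bundle_atlas A) (kernel_bundle (frame_bundle_atlas A) A fst) H \<and>
     (\<forall>a. invertible a \<longrightarrow>
        tangent_map (frame_bundle_atlas A) (frame_bundle_atlas A) (right_action a) ` H = H)"


section \<open>The bundle of inner products\<close>

type_synonym ('a, 'n) tensor =
  "'a \<times> (('a, real ^ 'n) tangent \<Rightarrow> ('a, real ^ 'n) tangent \<Rightarrow> real)"

text \<open>Symmetric \<open>n \<times> n\<close> matrices are represented by their entries indexed by unordered pairs,
  so that they form a Euclidean space.\<close>

type_synonym ('a, 'n) tensor_chart = "(('a, 'n) tensor, (real ^ 'n) \<times> (real ^ ('n uprod))) chart"

definition inner_product_on :: "'v::real_vector set \<Rightarrow> ('v \<Rightarrow> 'v \<Rightarrow> real) \<Rightarrow> bool"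
where
  "inner_product_on T g \<longleftrightarrow>
     (\<forall>v\<in>T. \<forall>w\<in>T. g v w = g w v) \<and>
     (\<forall>v\<in>T. \<forall>v'\<in>T. \<forall>w\<in>T. g (v + v') w = g v w + g v' w) \<and>
     (\<forall>r. \<forall>v\<in>T. \<forall>w\<in>T. g (r *\<^sub>R v) w = r * g v w) \<and>
     (\<forall>v\<in>T. v \<noteq> 0 \<longrightarrow> g v v > 0)"

text \<open>Bilinear forms on a tangent space are extended by zero, so that equal forms are equal
  as functions.\<close>

definition Sym_plus :: "('a, real ^ 'n::finite) chart set \<Rightarrow> ('a, 'n) tensor set"
where
  "Sym_plus A =
     {(x, g). x \<in> points A \<and> inner_product_on (tangent_space A x) g \<and>
        (\<forall>v w. \<not> (v \<in> tangent_space A x \<and> w \<in> tangent_space A x) \<longrightarrow> g v w = 0)}"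

definition symmetric_entries :: "('n::finite \<Rightarrow> 'n \<Rightarrow> real) \<Rightarrow> real ^ ('n uprod)"
where "symmetric_entries G = (\<chi> z. THE r. \<exists>i j. z = Upair i j \<and> r = G i j)"

lemma symmetric_entries_Upair:
  assumes "\<And>i j. G i j = G j i"
  shows "symmetric_entries G $ Upair i j = G i j"
  unfolding symmetric_entries_def
  by (auto simp: assms intro!: the_equality)

definition Sym_plus_chart ::
  "('a, real ^ 'n::finite) chart set \<Rightarrow> ('a, real ^ 'n) chart \<Rightarrow> ('a, 'n) tensor_chart"
where
  "Sym_plus_chart A c =
     ({(x, g) \<in> Sym_plus A. x \<in> chart_dom c},
      \<lambda>(x, g). (chart_map c x,
        symmetric_entries
          (\<lambda>i j. g (coord_vector A c x (axis i 1)) (coord_vector A c x (axis j 1)))))"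

definition Sym_plus_atlas :: "('a, real ^ 'n::finite) chart set \<Rightarrow> ('a, 'n) tensor_chart set"
where "Sym_plus_atlas A = Sym_plus_chart A ` A"

definition Sigma_map ::
  "('a, real ^ 'n::finite) chart set \<Rightarrow> ('a, 'n) frame \<Rightarrow> ('a, 'n) tensor"
where
  "Sigma_map A = (\<lambda>(x, u).
     (x, \<lambda>v w. if v \<in> tangent_space A x \<and> w \<in> tangent_space A x
               then inv u v \<bullet> inv u w else 0))"

end

(*
  By GL(n)-invariance, in the coordinates (y, m) of the frame bundle over a chart the horizontal
  space at (y, m) consists of the vectors (v, B m) with (v, B) in the horizontal space at (y, 1).
  In these coordinates Sigma is (y, m) |-> (y, S) with S = (m m^T)^(-1), and its differential sends
  (v, B m) to (v, -(B^T S + S B)), which depends on m only through S.  So all frames over a given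
  inner product push their horizontal spaces to the same space, the graph of a linear map over the
  tangent space of the base.  Applying (v, B) |-> (v, -(B^T S + S B)) to a local frame of the
  horizontal bundle along the section (y, 1) gives a local frame of the pushed forward bundle, so
  neither a smooth section of Sigma nor smoothness of the matrix inverse is needed.
*)

theory Submission
  imports Defs
begin

section \<open>Smooth maps\<close>

text \<open>The formula \<open>-(B^T S + S B)\<close> is the law of metric parallel transport: if
  \<open>(v, B)\<close> is horizontal at a coordinate frame, then \<open>-B\<close> is the
  connection matrix in the direction \<open>v\<close>, and a metric with matrix \<open>S\<close> is
  parallel along \<open>v\<close> when its derivative is \<open>-(B^T S + S B)\<close>.
  Complementarity to the vertical bundle is tested in one chart, as bijectivity of the first
  projection on the fibre. The push forward does not touch the first component, so the test carries
  over from frames to inner products, and it yields the unique lift as well. Two facts about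
  matrices carry the argument. Each fibre of \<open>Sigma\<close> must be nonempty, which amounts to
  the existence of an orthonormal frame. And the differential of \<open>Sigma\<close> involves the
  derivative of the matrix inverse, whose existence at a point comes from Cramer's rule. The fibres
  of both bundles are open subsets of Euclidean spaces, so atlases, vertical bundles and splittings
  are treated once for both, in the locale \<open>fibre_charts\<close>.\<close>

lemma C_k_on_cong:
  assumes "open S" "\<And>x. x \<in> S \<Longrightarrow> f x = g x" "C_k_on k S f"
  shows "C_k_on k S g"
  using assms(2,3)
proof (induction k arbitrary: f g)
  case 0
  then show ?case using continuous_on_cong[of S S f g] by auto
next
  case (Suc k)
  \<comment> \<open>Openness of \<open>S\<close> enters here: a derivative at \<open>x\<close>
    depends on the values near \<open>x\<close>, and \<open>f\<close> and \<open>g\<close> may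
    differ outside \<open>S\<close>.\<close>
  have D: "(g has_derivative frechet_derivative f (at x)) (at x)" if "x \<in> S" for x
  proof (rule has_derivative_transform_within_open[OF _ \<open>open S\<close> that Suc.prems(1)])
    show "(f has_derivative frechet_derivative f (at x)) (at x)"
      using Suc.prems(2) that by (simp add: frechet_derivative_works)
  qed
  have "frechet_derivative f (at x) v = frechet_derivative g (at x) v" if "x \<in> S" for x v
    using frechet_derivative_at[OF D[OF that]] by (rule fun_cong)
  moreover have "C_k_on k S (\<lambda>x. frechet_derivative f (at x) v)" for v using Suc.prems by simp
  ultimately have "C_k_on k S (\<lambda>x. frechet_derivative g (at x) v)" for v
    by (rule Suc.IH[where f = "\<lambda>x. frechet_derivative f (at x) v"])
  then show ?case using differentiableI[OF D] by simp
qed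

text \<open>\<open>frechet_derivative\<close> is a choice operator. Uniqueness of the derivative
  lets an explicit formula \<open>f'\<close> stand for it, so that the usual differentiation rules
  can be used at every order.\<close>

lemma C_k_on_SucI:
  assumes "open S" "\<And>x. x \<in> S \<Longrightarrow> (f has_derivative f' x) (at x)"
    and "\<And>v. C_k_on k S (\<lambda>x. f' x v)"
  shows "C_k_on (Suc k) S f"
proof -
  have "f' x v = frechet_derivative f (at x) v" if "x \<in> S" for x v
    using frechet_derivative_at[OF assms(2)[OF that]] by (rule fun_cong)
  then have "C_k_on k S (\<lambda>x. frechet_derivative f (at x) v)" for v
    by (rule C_k_on_cong[OF assms(1) _ assms(3)[of v]])
  then show ?thesis using differentiableI[OF assms(2)] by simp
qed

lemma C_k_on_SucD:
  assumes "C_k_on (Suc k) S f" "x \<in> S"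
  shows "(f has_derivative frechet_derivative f (at x)) (at x)"
  using assms by (simp add: frechet_derivative_works)

text \<open>Product and chain rule combine a derivative, of class \<open>k\<close>, with
  undifferentiated maps, of class \<open>Suc k\<close>; this brings both to class
  \<open>k\<close>.\<close>

lemma C_k_on_Suc_imp: "C_k_on (Suc k) S f \<Longrightarrow> C_k_on k S f"
proof (induction k arbitrary: f)
  case 0
  then show ?case
    by (auto simp: intro!: differentiable_imp_continuous_within continuous_at_imp_continuous_on)
next
  case (Suc k)
  then show ?case unfolding C_k_on.simps(2)[of "Suc k"] C_k_on.simps(2)[of k S f] by auto
qed

lemma C_k_on_subset: "C_k_on k S f \<Longrightarrow> T \<subseteq> S \<Longrightarrow> C_k_on k T f"
proof (induction k arbitrary: f)
  case 0 then show ?case using continuous_on_subset by auto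
next
  case (Suc k) then show ?case by auto
qed

lemma C_k_on_const: "open S \<Longrightarrow> C_k_on k S (\<lambda>x. c)"
proof (induction k arbitrary: c)
  case (Suc k)
  then show ?case by (intro C_k_on_SucI[where f' = "\<lambda>x v. 0"]) simp_all
qed auto

lemma C_k_on_bounded_linear:
  assumes "bounded_linear L" "open S" "C_k_on k S f"
  shows "C_k_on k S (\<lambda>x. L (f x))"
  using assms(3)
proof (induction k arbitrary: f)
  case 0 then show ?case using bounded_linear.continuous_on[OF assms(1)] by auto
next
  case (Suc k)
  show ?case
  proof (rule C_k_on_SucI[OF assms(2), where f' = "\<lambda>x v. L (frechet_derivative f (at x) v)"])
    show "((\<lambda>x. L (f x)) has_derivative (\<lambda>v. L (frechet_derivative f (at x) v))) (at x)" if "x \<in> S"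
      for x
      using bounded_linear.has_derivative[OF assms(1) C_k_on_SucD[OF Suc.prems that]] .
  qed (use Suc in auto)
qed

lemma C_k_on_ident: "open S \<Longrightarrow> C_k_on k S (\<lambda>x. x)"
proof (cases k)
  case (Suc j)
  assume "open S"
  then show ?thesis unfolding Suc
    by (intro C_k_on_SucI[where f' = "\<lambda>x v. v"] C_k_on_const) simp_all
qed auto

lemma C_k_on_add:
  assumes "open S" "C_k_on k S f" "C_k_on k S g"
  shows "C_k_on k S (\<lambda>x. f x + g x)"
  using assms(2,3)
proof (induction k arbitrary: f g)
  case 0 then show ?case by (auto intro: continuous_intros)
next
  case (Suc k)
  show ?case
  proof (rule C_k_on_SucI[OF assms(1)])
    show "((\<lambda>x. f x + g x) has_derivative
      (\<lambda>v. frechet_derivative f (at x) v + frechet_derivative g (at x) v)) (at x)" if "x \<in> S" for x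
      using has_derivative_add[OF C_k_on_SucD[OF Suc.prems(1) that]
        C_k_on_SucD[OF Suc.prems(2) that]] .
  qed (use Suc in auto)
qed

lemma C_k_on_bounded_bilinear:
  assumes "bounded_bilinear B" "open S" "C_k_on k S f" "C_k_on k S g"
  shows "C_k_on k S (\<lambda>x. B (f x) (g x))"
  using assms(3,4)
proof (induction k arbitrary: f g)
  case 0 then show ?case using bounded_bilinear.continuous_on[OF assms(1)] by auto
next
  case (Suc k)
  show ?case
  proof (rule C_k_on_SucI[OF assms(2)])
    show "((\<lambda>x. B (f x) (g x)) has_derivative
      (\<lambda>v. B (f x) (frechet_derivative g (at x) v) + B (frechet_derivative f (at x) v) (g x)))
        (at x)" if "x \<in> S" for x
      using bounded_bilinear.FDERIV[OF assms(1) C_k_on_SucD[OF Suc.prems(1) that]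
        C_k_on_SucD[OF Suc.prems(2) that]] .
  next
    fix v
    show "C_k_on k S (\<lambda>x. B (f x) (frechet_derivative g (at x) v) + B
      (frechet_derivative f (at x) v) (g x))"
      using Suc.prems C_k_on_Suc_imp[OF Suc.prems(1)] C_k_on_Suc_imp[OF Suc.prems(2)]
      by (intro C_k_on_add Suc.IH assms(2)) auto
  qed
qed

lemma C_k_on_sum:
  assumes "open S" "\<And>i. i \<in> I \<Longrightarrow> C_k_on k S (f i)"
  shows "C_k_on k S (\<lambda>x. \<Sum>i\<in>I. f i x)"
  using assms(2)
  by (induction I rule: infinite_finite_induct) (auto intro: C_k_on_const C_k_on_add assms(1))

lemma linear_eq_sum_Basis:
  fixes L :: "'e::euclidean_space \<Rightarrow> 'f::real_vector"
  assumes "linear L"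
  shows "L w = (\<Sum>b\<in>Basis. (w \<bullet> b) *\<^sub>R L b)"
proof -
  have "L w = L (\<Sum>b\<in>Basis. (w \<bullet> b) *\<^sub>R b)" by (simp only: euclidean_representation)
  also have "\<dots> = (\<Sum>b\<in>Basis. (w \<bullet> b) *\<^sub>R L b)"
    by (simp only: linear_sum[OF assms] linear_scale[OF assms])
  finally show ?thesis .
qed

text \<open>The chain rule applies the derivative of \<open>g\<close> at \<open>f x\<close> to a
  vector that itself moves with \<open>x\<close>, whereas \<open>C_k_on\<close> speaks of
  derivatives in a fixed direction. Expanding the vector in \<open>Basis\<close> of the Euclidean
  middle space leaves scalar functions times derivatives of \<open>g\<close> in fixed directions, to
  which the induction hypothesis applies.\<close>

lemma C_k_on_compose:
  fixes f :: "'d::real_normed_vector \<Rightarrow> 'e::euclidean_space" and g :: "'e \<Rightarrow> 'f::real_normed_vector"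
  assumes "open S" "C_k_on k S f" "C_k_on k T g" "f ` S \<subseteq> T"
  shows "C_k_on k S (\<lambda>x. g (f x))"
  using assms(2,3)
proof (induction k arbitrary: g)
  case 0 then show ?case using continuous_on_compose2 assms(4) by auto
next
  case (Suc k)
  show ?case
  proof (rule C_k_on_SucI[OF assms(1)])
    fix x assume x: "x \<in> S"
    then have "f x \<in> T" using assms(4) by auto
    note D = C_k_on_SucD[OF Suc.prems(2) this]
    have "((\<lambda>x. g (f x)) has_derivative
      (\<lambda>v. frechet_derivative g (at (f x)) (frechet_derivative f (at x) v))) (at x)"
      using diff_chain_at[OF C_k_on_SucD[OF Suc.prems(1) x] D] by (simp add: o_def)
    also have "(\<lambda>v. frechet_derivative g (at (f x)) (frechet_derivative f (at x) v)) =
        (\<lambda>v. \<Sum>b\<in>Basis. (frechet_derivative f (at x) v \<bullet> b) *\<^sub>R frechet_derivative g (at (f x)) b)"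
      by (rule ext) (rule linear_eq_sum_Basis[OF has_derivative_linear[OF D]])
    finally show "((\<lambda>x. g (f x)) has_derivative (\<lambda>v. \<Sum>b\<in>Basis.
       (frechet_derivative f (at x) v \<bullet> b) *\<^sub>R frechet_derivative g (at (f x)) b)) (at x)" .
  next
    fix v
    show "C_k_on k S (\<lambda>x. \<Sum>b\<in>Basis.
       (frechet_derivative f (at x) v \<bullet> b) *\<^sub>R frechet_derivative g (at (f x)) b)"
      using Suc C_k_on_Suc_imp[OF Suc.prems(1)]
      by (intro C_k_on_sum C_k_on_bounded_bilinear[OF bounded_bilinear_scaleR]
          C_k_on_bounded_linear[OF bounded_linear_inner_left] assms(1)
          Suc.IH[of "\<lambda>y. frechet_derivative g (at y) b" for b]) auto
  qed
qed

lemma smooth_on_cong: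
  "open S \<Longrightarrow> (\<And>x. x \<in> S \<Longrightarrow> f x = g x) \<Longrightarrow> smooth_on S f \<Longrightarrow> smooth_on S g"
  unfolding smooth_on_def using C_k_on_cong by blast

lemma smooth_on_subset: "smooth_on S f \<Longrightarrow> T \<subseteq> S \<Longrightarrow> smooth_on T f"
  unfolding smooth_on_def using C_k_on_subset by blast

lemma smooth_on_const: "open S \<Longrightarrow> smooth_on S (\<lambda>x. c)"
  unfolding smooth_on_def using C_k_on_const by blast

lemma smooth_on_ident: "open S \<Longrightarrow> smooth_on S (\<lambda>x. x)"
  unfolding smooth_on_def using C_k_on_ident by blast

lemma smooth_on_bounded_linear:
  "bounded_linear L \<Longrightarrow> open S \<Longrightarrow> smooth_on S f \<Longrightarrow> smooth_on S (\<lambda>x. L (f x))"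
  unfolding smooth_on_def using C_k_on_bounded_linear by blast

lemma smooth_on_add:
  "open S \<Longrightarrow> smooth_on S f \<Longrightarrow> smooth_on S g \<Longrightarrow> smooth_on S (\<lambda>x. f x + g x)"
  unfolding smooth_on_def using C_k_on_add by blast

lemma smooth_on_bounded_bilinear:
  "bounded_bilinear B \<Longrightarrow> open S \<Longrightarrow> smooth_on S f \<Longrightarrow> smooth_on S g \<Longrightarrow>
   smooth_on S (\<lambda>x. B (f x) (g x))"
  unfolding smooth_on_def using C_k_on_bounded_bilinear by blast

lemma smooth_on_sum:
  "open S \<Longrightarrow> (\<And>i. i \<in> I \<Longrightarrow> smooth_on S (f i)) \<Longrightarrow> smooth_on S (\<lambda>x. \<Sum>i\<in>I. f i x)"
  unfolding smooth_on_def by (simp add: C_k_on_sum)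

lemma smooth_on_compose:
  fixes f :: "'d::real_normed_vector \<Rightarrow> 'e::euclidean_space"
  shows "open S \<Longrightarrow> smooth_on S f \<Longrightarrow> smooth_on T g \<Longrightarrow> f ` S \<subseteq> T \<Longrightarrow> smooth_on S (\<lambda>x. g (f x))"
  unfolding smooth_on_def using C_k_on_compose by blast

lemma smooth_on_differentiable: "smooth_on S f \<Longrightarrow> x \<in> S \<Longrightarrow> f differentiable (at x)"
  unfolding smooth_on_def by (metis C_k_on.simps(2))

lemma smooth_on_continuous: "smooth_on S f \<Longrightarrow> continuous_on S f"
  unfolding smooth_on_def by (metis C_k_on.simps(1))

lemma smooth_on_frechet_derivative:
  "smooth_on S f \<Longrightarrow> smooth_on S (\<lambda>x. frechet_derivative f (at x) v)"
  unfolding smooth_on_def by (metis C_k_on.simps(2))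

lemma smooth_on_Pair:
  fixes f :: "'d::real_normed_vector \<Rightarrow> 'e::real_normed_vector"
    and g :: "'d \<Rightarrow> 'f::real_normed_vector"
  assumes "open S" "smooth_on S f" "smooth_on S g"
  shows "smooth_on S (\<lambda>x. (f x, g x))"
proof -
  have "bounded_linear (\<lambda>x::'e. (x, 0::'f))" "bounded_linear (\<lambda>x::'f. (0::'e, x))"
    by (intro bounded_linear_Pair bounded_linear_ident bounded_linear_zero)+
  then have "smooth_on S (\<lambda>x. (f x, 0) + (0, g x))"
    by (intro smooth_on_add[OF assms(1)] smooth_on_bounded_linear[OF _ assms(1,2)]
        smooth_on_bounded_linear[OF _ assms(1,3)])
  then show ?thesis by simp
qed

lemma smooth_on_linear:
  fixes L :: "'e::euclidean_space \<Rightarrow> 'f::real_normed_vector"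
  shows "linear L \<Longrightarrow> open S \<Longrightarrow> smooth_on S f \<Longrightarrow> smooth_on S (\<lambda>x. L (f x))"
  by (rule smooth_on_bounded_linear) (simp add: linear_conv_bounded_linear)

lemma smooth_on_bilinear:
  fixes B :: "'e::euclidean_space \<Rightarrow> 'f::euclidean_space \<Rightarrow> 'g::real_normed_vector"
  shows "bilinear B \<Longrightarrow> open S \<Longrightarrow> smooth_on S f \<Longrightarrow> smooth_on S g \<Longrightarrow> smooth_on S (\<lambda>x. B (f x) (g x))"
  by (rule smooth_on_bounded_bilinear) (simp add: bilinear_conv_bounded_bilinear)

lemma smooth_on_fst: "open S \<Longrightarrow> smooth_on S fst"
  using smooth_on_bounded_linear[OF bounded_linear_fst _ smooth_on_ident] .

lemma smooth_on_snd: "open S \<Longrightarrow> smooth_on S snd"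
  using smooth_on_bounded_linear[OF bounded_linear_snd _ smooth_on_ident] .

lemma smooth_on_componentwise:
  fixes f :: "'d::real_normed_vector \<Rightarrow> 'e::euclidean_space"
  assumes "open S" "\<And>b. b \<in> Basis \<Longrightarrow> smooth_on S (\<lambda>x. f x \<bullet> b)"
  shows "smooth_on S f"
proof -
  have "smooth_on S (\<lambda>x. \<Sum>b\<in>Basis. (f x \<bullet> b) *\<^sub>R b)"
    using assms by (intro smooth_on_sum smooth_on_bounded_linear[OF bounded_linear_scaleR_left])
      auto
  then show ?thesis by (simp add: euclidean_representation)
qed

lemma smooth_on_vec_lambda:
  fixes f :: "'d::real_normed_vector \<Rightarrow> 'n::finite \<Rightarrow> 'e::euclidean_space"
  assumes "open S" "\<And>i. smooth_on S (\<lambda>x. f x i)"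
  shows "smooth_on S (\<lambda>x. \<chi> i. f x i)"
proof (rule smooth_on_componentwise[OF assms(1)])
  fix b :: "'e ^ 'n" assume "b \<in> Basis"
  then obtain i e where "b = axis i e" unfolding Basis_vec_def by blast
  then have "(\<chi> i. f x i) \<bullet> b = f x i \<bullet> e" for x by (simp add: inner_axis)
  then show "smooth_on S (\<lambda>x. (\<chi> i. f x i) \<bullet> b)"
    using smooth_on_bounded_linear[OF bounded_linear_inner_left assms(1) assms(2)[of i], of e]
      by simp
qed

text \<open>Both the base point and the vector fed to the derivative vary; expanding
  \<open>h x\<close> in \<open>Basis\<close> separates the two dependences. The components of a
  vector field in another chart have this shape.\<close>

lemma smooth_on_frechet_derivative_apply:
  fixes g :: "'d::real_normed_vector \<Rightarrow> 'e::euclidean_space"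
  assumes "open T" "smooth_on S f" "smooth_on T g" "g ` T \<subseteq> S" "smooth_on T h"
  shows "smooth_on T (\<lambda>x. frechet_derivative f (at (g x)) (h x))"
proof -
  have "smooth_on T (\<lambda>x. (h x \<bullet> b) *\<^sub>R frechet_derivative f (at (g x)) b)" for b
    using smooth_on_compose[OF assms(1,3) smooth_on_frechet_derivative[OF assms(2)] assms(4)]
    by (rule smooth_on_bounded_bilinear[OF bounded_bilinear_scaleR assms(1)
        smooth_on_bounded_linear[OF bounded_linear_inner_left assms(1,5)]])
  then have "smooth_on T (\<lambda>x. \<Sum>b\<in>Basis. (h x \<bullet> b) *\<^sub>R frechet_derivative f (at (g x)) b)"
    by (intro smooth_on_sum assms(1))
  then show ?thesis
  proof (rule smooth_on_cong[OF assms(1), rotated])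
    show "(\<Sum>b\<in>Basis. (h x \<bullet> b) *\<^sub>R frechet_derivative f (at (g x)) b) =
      frechet_derivative f (at (g x)) (h x)" if "x \<in> T" for x
    using that assms(2,4) smooth_on_differentiable[of S f "g x"]
    by (intro linear_eq_sum_Basis[symmetric] linear_frechet_derivative) auto
  qed
qed

section \<open>Charts and tangent vectors\<close>

lemma chart_inv_in_dom: "y \<in> chart_map c ` chart_dom c \<Longrightarrow> chart_inv c y \<in> chart_dom c"
  unfolding chart_inv_def by (rule inv_into_into)

lemma tangent_space_transition:
  assumes "v \<in> tangent_space A p" "c \<in> charts_at A p" "d \<in> charts_at A p"
  shows "frechet_derivative (transition c d) (at (chart_map c p)) (v c) = v d"
  using CollectD[OF assms(1)[unfolded tangent_space_def], THEN conjunct2, THEN bspec, OF assms(2),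
      THEN bspec, OF assms(3)] by (rule sym)

lemma tangent_space_zero:
  assumes "v \<in> tangent_space A p" "c \<notin> charts_at A p"
  shows "v c = 0"
  using CollectD[OF assms(1)[unfolded tangent_space_def], THEN conjunct1, THEN spec, THEN mp, OF
    assms(2)] .

lemma charts_atD: "c \<in> charts_at A p \<Longrightarrow> c \<in> A \<and> p \<in> chart_dom c"
  by (simp add: charts_at_def)

context
  fixes A :: "('a, 'e::euclidean_space) chart set"
  assumes A: "smooth_atlas A"
begin

lemma chart_inv_chart_map: "c \<in> A \<Longrightarrow> p \<in> chart_dom c \<Longrightarrow> chart_inv c (chart_map c p) = p"
  using A unfolding chart_inv_def smooth_atlas_def by (simp add: inv_into_f_f)

lemma transition_chart_map:
  "c \<in> A \<Longrightarrow> p \<in> chart_dom c \<Longrightarrow> transition c d (chart_map c p) = chart_map d p"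
  by (simp add: transition_def chart_inv_chart_map)

lemma open_overlap: "c \<in> A \<Longrightarrow> d \<in> A \<Longrightarrow> open (chart_map c ` (chart_dom c \<inter> chart_dom d))"
  using A unfolding smooth_atlas_def by blast

lemma open_chart_image: "c \<in> A \<Longrightarrow> open (chart_map c ` chart_dom c)"
  using A unfolding smooth_atlas_def by blast

lemma smooth_on_transition:
  "c \<in> A \<Longrightarrow> d \<in> A \<Longrightarrow> smooth_on (chart_map c ` (chart_dom c \<inter> chart_dom d)) (transition c d)"
  using A unfolding smooth_atlas_def by blast

text \<open>Turns an image under one chart into a preimage under the coordinate change, so that
  continuity of \<open>transition d c\<close> yields openness.\<close>

lemma chart_map_preimage:
  assumes "c \<in> A" "d \<in> A"
  shows "chart_map d ` ({q \<in> chart_dom c. chart_map c q \<in> U} \<inter> chart_dom d) =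
    chart_map d ` (chart_dom d \<inter> chart_dom c) \<inter> transition d c -` U" (is "?L = ?R")
proof
  show "?L \<subseteq> ?R" by (auto simp: transition_chart_map[OF assms(2)])
  show "?R \<subseteq> ?L"
  proof
    fix y assume "y \<in> ?R"
    then obtain q where "q \<in> chart_dom d" "q \<in> chart_dom c" "y = chart_map d q"
      "transition d c y \<in> U"
      by auto
    then show "y \<in> ?L" using transition_chart_map[OF assms(2), of q c] by auto
  qed
qed

lemma open_chart_map_preimage:
  assumes "c \<in> A" "d \<in> A" "open U"
  shows "open (chart_map d ` ({q \<in> chart_dom c. chart_map c q \<in> U} \<inter> chart_dom d))"
  unfolding chart_map_preimage[OF assms(1,2)]
  using smooth_on_continuous[OF smooth_on_transition[OF assms(2,1)]] open_overlap[OF assms(2,1)]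
    assms(3)
  by (rule continuous_open_preimage)

lemma openin_chart_preimage:
  assumes "c \<in> A" "open U"
  shows "openin (atlas_topology A) {q \<in> chart_dom c. chart_map c q \<in> U}"
  unfolding openin_atlas_topology[OF A]
  using assms open_chart_map_preimage by (auto simp: points_def)

section \<open>Derivatives of coordinate changes and tangent vectors in one chart\<close>

lemma transition_has_derivative:
  assumes "c \<in> charts_at A p" "d \<in> charts_at A p"
  shows "(transition c d has_derivative frechet_derivative (transition c d) (at (chart_map c p)))
    (at (chart_map c p))"
  using smooth_on_differentiable[OF smooth_on_transition[of c d]] charts_atD[OF assms(1)]
    charts_atD[OF assms(2)]
  by (auto simp: frechet_derivative_works[symmetric])

lemma linear_transition_derivative:
  "c \<in> charts_at A p \<Longrightarrow> d \<in> charts_at A p \<Longrightarrow>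
   linear (frechet_derivative (transition c d) (at (chart_map c p)))"
  using transition_has_derivative has_derivative_linear by blast

text \<open>\<open>transition c c\<close> is known to be the identity only on the image of the
  chart, which suffices because that image is open.\<close>

lemma transition_derivative_self:
  assumes "c \<in> charts_at A p"
  shows "frechet_derivative (transition c c) (at (chart_map c p)) v = v"
proof -
  note c = charts_atD[OF assms]
  have "(transition c c has_derivative (\<lambda>v. v)) (at (chart_map c p))"
  proof (rule has_derivative_transform_within_open[OF has_derivative_ident open_chart_image])
    show "y = transition c c y" if "y \<in> chart_map c ` chart_dom c" for y
      using that c by (auto simp: transition_chart_map)
  qed (use c in auto)
  then show ?thesis using frechet_derivative_at by metis
qed

text \<open>Chain rule on the overlap. This cocycle rule is what makes the family
  \<open>coord_vector\<close> compatible with all coordinate changes.\<close>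

lemma transition_derivative_comp:
  assumes "c \<in> charts_at A p" "d \<in> charts_at A p" "e \<in> charts_at A p"
  shows "frechet_derivative (transition d e) (at (chart_map d p))
      (frechet_derivative (transition c d) (at (chart_map c p)) v) =
    frechet_derivative (transition c e) (at (chart_map c p)) v"
proof -
  note c = charts_atD[OF assms(1)] and d = charts_atD[OF assms(2)] and e = charts_atD[OF assms(3)]
  have eq: "transition c d (chart_map c p) = chart_map d p" using c transition_chart_map by blast
  have "((\<lambda>y. transition d e (transition c d y)) has_derivative
      (\<lambda>v. frechet_derivative (transition d e) (at (chart_map d p))
        (frechet_derivative (transition c d) (at (chart_map c p)) v))) (at (chart_map c p))"
    using diff_chain_at[OF transition_has_derivative[OF assms(1,2)], of "transition d e"]
      transition_has_derivative[OF assms(2,3)] eq by (simp add: o_def)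
  then have "(transition c e has_derivative
      (\<lambda>v. frechet_derivative (transition d e) (at (chart_map d p))
        (frechet_derivative (transition c d) (at (chart_map c p)) v))) (at (chart_map c p))"
  proof (rule has_derivative_transform_within_open[OF _ open_overlap[of c d]])
    \<comment> \<open>The overlap of \<open>c\<close> and \<open>d\<close> is a large enough
      neighbourhood: for \<open>y = chart_map c q\<close> both sides are literally
      \<open>chart_map e q\<close>, whether or not \<open>q\<close> lies in the domain of
      \<open>e\<close>.\<close>
    show "transition d e (transition c d y) = transition c e y"
      if "y \<in> chart_map c ` (chart_dom c \<inter> chart_dom d)" for y
      using that c d by (auto simp: transition_chart_map)
  qed (use c d in auto)
  from frechet_derivative_at[OF this] show ?thesis by metis
qed

lemma coord_vector_apply:
  "c \<in> charts_at A p \<Longrightarrow> coord_vector A c p e c = e"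
  by (simp add: coord_vector_def transition_derivative_self)

lemma coord_vector_transition:
  "d \<in> charts_at A p \<Longrightarrow>
   coord_vector A c p e d = frechet_derivative (transition c d) (at (chart_map c p)) e"
  by (simp add: coord_vector_def)

lemma coord_vector_in_tangent_space:
  "c \<in> charts_at A p \<Longrightarrow> coord_vector A c p e \<in> tangent_space A p"
  by (simp add: coord_vector_def tangent_space_def transition_derivative_comp)

text \<open>Compatibility, together with the value 0 at all charts not around \<open>p\<close>,
  recovers a tangent vector from a single component. This is why everything below can be computed in
  one chart.\<close>

lemma coord_vector_component:
  assumes "c \<in> charts_at A p" "v \<in> tangent_space A p"
  shows "coord_vector A c p (v c) = v"
proof
  fix d
  show "coord_vector A c p (v c) d = v d"
    using tangent_space_transition[OF assms(2,1)] tangent_space_zero[OF assms(2)]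
    by (simp add: coord_vector_def)
qed

lemma linear_coord_vector:
  assumes "c \<in> charts_at A p"
  shows "linear (coord_vector A c p)"
proof (rule linearI)
  show "coord_vector A c p (x + y) = coord_vector A c p x + coord_vector A c p y" for x y
    using linear_transition_derivative[OF assms]
    by (auto simp: coord_vector_def fun_eq_iff linear_add)
  show "coord_vector A c p (r *\<^sub>R x) = r *\<^sub>R coord_vector A c p x" for r x
    using linear_transition_derivative[OF assms]
    by (auto simp: coord_vector_def fun_eq_iff scaleR_fun_def linear_scale)
qed

lemma inj_coord_vector: "c \<in> charts_at A p \<Longrightarrow> inj (coord_vector A c p)"
  by (metis coord_vector_apply injI)

lemma tangent_space_eq_range:
  assumes "c \<in> charts_at A p"
  shows "tangent_space A p = range (coord_vector A c p)"
proof
  show "tangent_space A p \<subseteq> range (coord_vector A c p)"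
    using coord_vector_component[OF assms] by (metis rangeI subsetI)
  show "range (coord_vector A c p) \<subseteq> tangent_space A p"
    using coord_vector_in_tangent_space[OF assms] by auto
qed

lemma tangent_vector_eqI:
  assumes "c \<in> charts_at A p" "v \<in> tangent_space A p" "w \<in> tangent_space A p" "v c = w c"
  shows "v = w"
  using assms coord_vector_component by metis

lemma subspace_tangent_space: "c \<in> charts_at A p \<Longrightarrow> subspace (tangent_space A p)"
  by (simp add: tangent_space_eq_range linear_coord_vector linear_subspace_image)

text \<open>Smoothness in \<open>c\<close> spreads to every chart \<open>d\<close>, since the
  \<open>d\<close>-component is the derivative of \<open>transition c d\<close> at a moving point,
  applied to a moving vector.\<close>

lemma smooth_vector_field_coords:
  assumes c: "c \<in> A" and U: "open U" "U \<subseteq> chart_map c ` chart_dom c" and Z: "smooth_on U Z"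
  shows "smooth_vector_field_on A {q \<in> chart_dom c. chart_map c q \<in> U}
    (\<lambda>p. coord_vector A c p (Z (chart_map c p)))"
  unfolding smooth_vector_field_on_def
proof (intro conjI ballI)
  let ?W = "{q \<in> chart_dom c. chart_map c q \<in> U}"
  show "coord_vector A c p (Z (chart_map c p)) \<in> tangent_space A p" if "p \<in> ?W" for p
    using that c by (intro coord_vector_in_tangent_space) (simp add: charts_at_def)
  fix d assume d: "d \<in> A"
  let ?S = "chart_map d ` (?W \<inter> chart_dom d)"
  have S: "open ?S" using open_chart_map_preimage[OF c d U(1)] .
  have T: "smooth_on ?S (transition d c)"
    by (rule smooth_on_subset[OF smooth_on_transition[OF d c]]) auto
  have im: "transition d c y \<in> U \<and> transition d c y \<in> chart_map c ` (chart_dom c \<inter> chart_dom d)"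
    if "y \<in> ?S" for y
    using that by (auto simp: transition_chart_map[OF d])
  have "smooth_on ?S (\<lambda>y. frechet_derivative (transition c d) (at (transition d c y))
    (Z (transition d c y)))"
    by (rule smooth_on_frechet_derivative_apply[OF S smooth_on_transition[OF c d] T _
      smooth_on_compose[OF S T Z]])
      (use im in auto)
  then show "smooth_on ?S
      (\<lambda>y. coord_vector A c (chart_inv d y) (Z (chart_map c (chart_inv d y))) d)"
  proof (rule smooth_on_cong[OF S, rotated])
    fix y assume "y \<in> ?S"
    then have "d \<in> charts_at A (chart_inv d y)"
      using chart_inv_in_dom[of y d] d by (auto simp: charts_at_def)
    then show "frechet_derivative (transition c d) (at (transition d c y)) (Z (transition d c y)) =
        coord_vector A c (chart_inv d y) (Z (chart_map c (chart_inv d y))) d"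
      by (simp add: coord_vector_transition transition_def)
  qed
qed

lemma fibre_eq_coord_image:
  assumes "D \<subseteq> tangent_bundle A" "c \<in> charts_at A p"
  shows "D `` {p} = coord_vector A c p ` (\<lambda>v. v c) ` (D `` {p})"
proof -
  have "coord_vector A c p (v c) = v" if "v \<in> D `` {p}" for v
    using that assms coord_vector_component unfolding tangent_bundle_def by blast
  then show ?thesis by (force simp: image_image)
qed

text \<open>A local frame may be given by its components \<open>Z i\<close> in one chart:
  \<open>coord_vector\<close> is linear and injective at each point, so it carries independence and
  spans back to the fibres of \<open>D\<close>.\<close>

lemma smooth_subbundleI:
  assumes D: "D \<subseteq> tangent_bundle A"
    and ex: "\<And>p. p \<in> points A \<Longrightarrow> \<exists>c U (k::nat) Z. c \<in> charts_at A p \<and> open U \<and> chart_map c p \<in> U \<and>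
      U \<subseteq> chart_map c ` chart_dom c \<and> (\<forall>i<k. smooth_on U (Z i)) \<and>
      (\<forall>q\<in>chart_dom c. chart_map c q \<in> U \<longrightarrow>
         inj_on (\<lambda>i. Z i (chart_map c q)) {..<k} \<and>
         independent ((\<lambda>i. Z i (chart_map c q)) ` {..<k}) \<and>
         span ((\<lambda>i. Z i (chart_map c q)) ` {..<k}) = (\<lambda>v. v c) ` (D `` {q}))"
  shows "smooth_subbundle A D"
  unfolding smooth_subbundle_def
proof (intro conjI ballI)
  fix p assume "p \<in> points A"
  from ex[OF this] obtain c U and k :: nat and Z
    where c: "c \<in> charts_at A p" and U: "open U" "chart_map c p \<in> U" "U \<subseteq> chart_map c ` chart_dom c"
      and Z: "\<forall>i<k. smooth_on U (Z i)"
      and *: "\<forall>q\<in>chart_dom c. chart_map c q \<in> U \<longrightarrow>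
         inj_on (\<lambda>i. Z i (chart_map c q)) {..<k} \<and>
         independent ((\<lambda>i. Z i (chart_map c q)) ` {..<k}) \<and>
         span ((\<lambda>i. Z i (chart_map c q)) ` {..<k}) = (\<lambda>v. v c) ` (D `` {q})"
    by - (elim exE conjE, rule that)
  let ?W = "{q \<in> chart_dom c. chart_map c q \<in> U}"
  let ?X = "\<lambda>i q. coord_vector A c q (Z i (chart_map c q))"
  have cA: "c \<in> A" "p \<in> chart_dom c" using charts_atD[OF c] by auto
  have fib: "inj_on (\<lambda>i. ?X i q) {..<k} \<and> independent ((\<lambda>i. ?X i q) ` {..<k}) \<and>
      span ((\<lambda>i. ?X i q) ` {..<k}) = D `` {q}" if q: "q \<in> ?W" for q
  proof -
    have cq: "c \<in> charts_at A q" using q cA by (simp add: charts_at_def)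
    note lin = linear_coord_vector[OF cq] and inj = inj_coord_vector[OF cq]
    let ?Z = "\<lambda>i. Z i (chart_map c q)"
    have i: "inj_on ?Z {..<k}" "independent (?Z ` {..<k})"
      "span (?Z ` {..<k}) = (\<lambda>v. v c) ` (D `` {q})"
      using * q by auto
    have im: "(\<lambda>i. ?X i q) ` {..<k} = coord_vector A c q ` ?Z ` {..<k}" by (simp add: image_image)
    have "inj_on (\<lambda>i. ?X i q) {..<k}"
      using i(1) inj by (auto simp: inj_on_def)
    moreover have "independent (coord_vector A c q ` ?Z ` {..<k})"
      using linear_independent_injective_image[OF lin i(2)] inj inj_on_subset by blast
    moreover have "span (coord_vector A c q ` ?Z ` {..<k}) = D `` {q}"
      using linear_span_image[OF lin, of "?Z ` {..<k}"] i(3) fibre_eq_coord_image[OF D cq] by simp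
    ultimately show ?thesis unfolding im by blast
  qed
  show "\<exists>W (k::nat) X. openin (atlas_topology A) W \<and> p \<in> W \<and>
      (\<forall>i<k. smooth_vector_field_on A W (X i)) \<and>
      (\<forall>q\<in>W. inj_on (\<lambda>i. X i q) {..<k} \<and> independent ((\<lambda>i. X i q) ` {..<k}) \<and>
             span ((\<lambda>i. X i q) ` {..<k}) = D `` {q})"
    using openin_chart_preimage[OF cA(1) U(1)] cA U(2) fib
      smooth_vector_field_coords[OF cA(1) U(1,3)] Z
    by (intro exI[of _ ?W] exI[of _ k] exI[of _ ?X]) auto
qed (fact D)

end

text \<open>\<open>tangent_map\<close> is computed in a chart picked by \<open>SOME\<close>. The
  chain rule through that chart, the local expression \<open>G\<close> and the charts of the target
  removes the choice: any chart \<open>c\<close> around \<open>p\<close> may be used, with any map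
  \<open>G\<close> that describes \<open>f\<close> near \<open>p\<close>.\<close>

lemma tangent_map_coords:
  fixes A :: "('a, 'e::euclidean_space) chart set" and B :: "('b, 'f::euclidean_space) chart set"
  assumes A: "smooth_atlas A" and B: "smooth_atlas B"
    and c: "c \<in> charts_at A p" and d: "d \<in> B" and v: "v \<in> tangent_space A p"
    and N: "open N" "chart_map c p \<in> N" "N \<subseteq> chart_map c ` chart_dom c"
    and f: "\<And>q. q \<in> chart_dom c \<Longrightarrow> chart_map c q \<in> N \<Longrightarrow>
      f q \<in> chart_dom d \<and> chart_map d (f q) = G (chart_map c q)"
    and G: "(G has_derivative G') (at (chart_map c p))"
  shows "tangent_map A B f (p, v) = (f p, coord_vector B d (f p) (G' (v c)))"
proof -
  define c' where "c' = (SOME c. c \<in> charts_at A p)"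
  have c': "c' \<in> charts_at A p" unfolding c'_def using c by (rule someI)
  note cA = charts_atD[OF c] and cA' = charts_atD[OF c']
  have dfp: "d \<in> charts_at B (f p)" using f[of p] cA N d by (simp add: charts_at_def)
  have Gp: "G (chart_map c p) = chart_map d (f p)" using f[of p] cA N by simp
  have "frechet_derivative (\<lambda>y. chart_map d' (f (chart_inv c' y))) (at (chart_map c' p)) (v c') =
      frechet_derivative (transition d d') (at (chart_map d (f p))) (G' (v c))"
    if d': "d' \<in> charts_at B (f p)" for d'
  proof -
    \<comment> \<open>The neighbourhood of \<open>p\<close> on which \<open>G\<close> describes
      \<open>f\<close>, seen in the selected chart \<open>c'\<close>.\<close>
    let ?M = "chart_map c' ` ({q \<in> chart_dom c. chart_map c q \<in> N} \<inter> chart_dom c')"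
    let ?D = "\<lambda>w. frechet_derivative (transition d d') (at (chart_map d (f p)))
      (G' (frechet_derivative (transition c' c) (at (chart_map c' p)) w))"
    have t: "transition c' c (chart_map c' p) = chart_map c p" using transition_chart_map[OF A] cA'
      by blast
    have "((\<lambda>y. G (transition c' c y)) has_derivative
        (\<lambda>w. G' (frechet_derivative (transition c' c) (at (chart_map c' p)) w)))
          (at (chart_map c' p))"
      using diff_chain_at[OF transition_has_derivative[OF A c' c], of G G'] G t by (simp add: o_def)
    then have "((\<lambda>y. transition d d' (G (transition c' c y))) has_derivative ?D)
      (at (chart_map c' p))"
      using diff_chain_at[of "\<lambda>y. G (transition c' c y)" _ "chart_map c' p" "transition d d'"]
        transition_has_derivative[OF B dfp d']
      by (simp add: o_def t Gp)
    then have "((\<lambda>y. chart_map d' (f (chart_inv c' y))) has_derivative ?D) (at (chart_map c' p))"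
    proof (rule has_derivative_transform_within_open[OF _ open_chart_map_preimage[OF A]])
      fix y assume "y \<in> ?M"
      then obtain q where q: "q \<in> chart_dom c" "q \<in> chart_dom c'" "chart_map c q \<in> N"
        "y = chart_map c' q"
        by auto
      then show "transition d d' (G (transition c' c y)) = chart_map d' (f (chart_inv c' y))"
        using cA' f[of q] d transition_chart_map[OF B d, of "f q" d']
        by (simp add: transition_chart_map[OF A] chart_inv_chart_map[OF A])
    qed (use N cA cA' in auto)
    from frechet_derivative_at[OF this]
    have "frechet_derivative (\<lambda>y. chart_map d' (f (chart_inv c' y))) (at (chart_map c' p)) (v c') =
      ?D (v c')"
      by metis
    moreover have "frechet_derivative (transition c' c) (at (chart_map c' p)) (v c') = v c"
      by (rule tangent_space_transition[OF v c' c])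
    ultimately show ?thesis by simp
  qed
  then show ?thesis
    unfolding tangent_map_def coord_vector_def by (auto simp: Let_def c'_def fun_eq_iff)
qed

section \<open>Bundles with fibre charts\<close>

lemma smooth_subbundleE:
  assumes "smooth_subbundle A D" "p \<in> points A"
  obtains W and k :: nat and X where "openin (atlas_topology A) W" "p \<in> W"
    "\<forall>i<k. smooth_vector_field_on A W (X i)"
    "\<forall>q\<in>W. inj_on (\<lambda>i. X i q) {..<k} \<and> independent ((\<lambda>i. X i q) ` {..<k}) \<and>
       span ((\<lambda>i. X i q) ` {..<k}) = D `` {q}"
  using assms(1)[unfolded smooth_subbundle_def, THEN conjunct2, THEN bspec, OF assms(2)]
  by - (elim exE conjE, rule that)

lemma smooth_subbundle_fibre_subspace:
  assumes "smooth_subbundle B D" "p \<in> points B"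
  shows "subspace (D `` {p})"
proof -
  obtain W and k :: nat and X where "p \<in> W" and *: "\<forall>q\<in>W. inj_on (\<lambda>i. X i q) {..<k} \<and>
      independent ((\<lambda>i. X i q) ` {..<k}) \<and> span ((\<lambda>i. X i q) ` {..<k}) = D `` {q}"
    using assms by (rule smooth_subbundleE)
  from *[THEN bspec, OF \<open>p \<in> W\<close>] show ?thesis by (metis subspace_span)
qed

text \<open>Since one component determines a tangent vector, a fibre of a subbundle may be replaced
  by this subset of the model space, and statements about fibres become linear algebra
  there.\<close>

definition chart_fibre ::
  "('a \<times> ('a, 'e) tangent) set \<Rightarrow> ('a, 'e) chart \<Rightarrow> 'a \<Rightarrow> 'e set"
where "chart_fibre D c p = (\<lambda>v. v c) ` (D `` {p})"

lemma chart_fibreI: "(p, v) \<in> D \<Longrightarrow> v k \<in> chart_fibre D k p"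
  by (auto simp: chart_fibre_def)

lemma subspace_chart_fibre:
  assumes "subspace (D `` {p})" shows "subspace (chart_fibre D k p)"
proof -
  have "linear (\<lambda>v. v k)" by (rule linearI) (auto simp: scaleR_fun_def)
  then show ?thesis unfolding chart_fibre_def using assms by (rule linear_subspace_image)
qed

text \<open>A bundle \<open>fst\<close> from \<open>E\<close> to the manifold of \<open>A\<close>,
  with typical fibre an open set \<open>F\<close> of a Euclidean space. Over the chart
  \<open>c\<close> the fibre coordinate is \<open>\<rho> c\<close>, and \<open>L c d y\<close>
  changes fibre coordinates from \<open>c\<close> to \<open>d\<close> over the point with
  \<open>c\<close>-coordinates \<open>y\<close>. The instances below have as \<open>F\<close> the
  invertible matrices and the coordinates of positive definite matrices.\<close>

locale fibre_charts =
  fixes A :: "('a, 'e::euclidean_space) chart set"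
    and E :: "('a \<times> 'b) set"
    and F :: "'f::euclidean_space set"
    and \<rho> :: "('a, 'e) chart \<Rightarrow> 'a \<times> 'b \<Rightarrow> 'f"
    and L :: "('a, 'e) chart \<Rightarrow> ('a, 'e) chart \<Rightarrow> 'e \<Rightarrow> 'f \<Rightarrow> 'f"
  assumes A: "smooth_atlas A"
    and base: "p \<in> E \<Longrightarrow> fst p \<in> points A"
    and open_F: "open F"
    and bij: "c \<in> charts_at A x \<Longrightarrow> bij_betw (\<rho> c) {p \<in> E. fst p = x} F"
    and trans: "p \<in> E \<Longrightarrow> c \<in> charts_at A (fst p) \<Longrightarrow> d \<in> charts_at A (fst p) \<Longrightarrow>
      \<rho> d p = L c d (chart_map c (fst p)) (\<rho> c p)"
    and smooth_L: "c \<in> A \<Longrightarrow> d \<in> A \<Longrightarrow>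
      smooth_on (chart_map c ` (chart_dom c \<inter> chart_dom d) \<times> F) (\<lambda>z. L c d (fst z) (snd z))"
begin

definition lift_chart :: "('a, 'e) chart \<Rightarrow> ('a \<times> 'b, 'e \<times> 'f) chart"
  where "lift_chart c = ({p \<in> E. fst p \<in> chart_dom c}, \<lambda>p. (chart_map c (fst p), \<rho> c p))"

definition lift_atlas :: "('a \<times> 'b, 'e \<times> 'f) chart set"
  where "lift_atlas = lift_chart ` A"

lemma dom_lift_chart: "chart_dom (lift_chart c) = {p \<in> E. fst p \<in> chart_dom c}"
  by (simp add: lift_chart_def)

lemma map_lift_chart: "chart_map (lift_chart c) p = (chart_map c (fst p), \<rho> c p)"
  by (simp add: lift_chart_def)

lemma lift_point_exists:
  assumes "c \<in> charts_at A x" "m \<in> F"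
  obtains p where "p \<in> E" "fst p = x" "\<rho> c p = m"
proof -
  have "m \<in> \<rho> c ` {p \<in> E. fst p = x}" using bij[OF assms(1)] assms(2) by (simp add: bij_betw_def)
  then show ?thesis using that by blast
qed

lemma rho_in_F: "p \<in> E \<Longrightarrow> c \<in> charts_at A (fst p) \<Longrightarrow> \<rho> c p \<in> F"
  using bij[of c "fst p"] by (auto simp: bij_betw_def)

text \<open>Fibrewise bijectivity onto the same \<open>F\<close> makes the image a product. The set
  \<open>S\<close> is kept general to cover chart domains as well as overlaps.\<close>

lemma lift_chart_image:
  assumes "c \<in> A" "S \<subseteq> chart_dom c"
  shows "chart_map (lift_chart c) ` {p \<in> E. fst p \<in> S} = chart_map c ` S \<times> F"
proof
  show "chart_map (lift_chart c) ` {p \<in> E. fst p \<in> S} \<subseteq> chart_map c ` S \<times> F"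
  proof (rule image_subsetI)
    fix p assume "p \<in> {p \<in> E. fst p \<in> S}"
    then show "chart_map (lift_chart c) p \<in> chart_map c ` S \<times> F"
      using assms rho_in_F[of p c] by (auto simp: map_lift_chart charts_at_def)
  qed
  show "chart_map c ` S \<times> F \<subseteq> chart_map (lift_chart c) ` {p \<in> E. fst p \<in> S}"
  proof
    fix z assume "z \<in> chart_map c ` S \<times> F"
    then obtain x m where x: "x \<in> S" "z = (chart_map c x, m)" "m \<in> F" by auto
    then have "c \<in> charts_at A x" using assms by (auto simp: charts_at_def)
    from lift_point_exists[OF this x(3)] obtain p where "p \<in> E" "fst p = x" "\<rho> c p = m" .
    then show "z \<in> chart_map (lift_chart c) ` {p \<in> E. fst p \<in> S}"
      using x by (intro image_eqI[of _ _ p]) (auto simp: map_lift_chart)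
  qed
qed

lemma lift_chart_range:
  "c \<in> A \<Longrightarrow> chart_map (lift_chart c) ` chart_dom (lift_chart c) = chart_map c ` chart_dom c \<times> F"
  unfolding dom_lift_chart by (rule lift_chart_image) auto

lemma lift_chart_overlap:
  "c \<in> A \<Longrightarrow> chart_map (lift_chart c) ` (chart_dom (lift_chart c) \<inter> chart_dom (lift_chart d)) =
    chart_map c ` (chart_dom c \<inter> chart_dom d) \<times> F"
  using lift_chart_image[of c "chart_dom c \<inter> chart_dom d"]
  by (simp add: dom_lift_chart Collect_conj_eq Int_ac)

lemma inj_on_lift_chart:
  assumes "c \<in> A"
  shows "inj_on (chart_map (lift_chart c)) (chart_dom (lift_chart c))"
proof (rule inj_onI)
  fix p q assume p: "p \<in> chart_dom (lift_chart c)" and q: "q \<in> chart_dom (lift_chart c)"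
    and eq: "chart_map (lift_chart c) p = chart_map (lift_chart c) q"
  have "fst p = fst q"
    using p q eq assms A by (auto simp: dom_lift_chart map_lift_chart smooth_atlas_def inj_on_def)
  moreover have "inj_on (\<rho> c) {r \<in> E. fst r = fst p}"
    using bij[of c "fst p"] p assms by (auto simp: dom_lift_chart charts_at_def bij_betw_def)
  ultimately show "p = q"
    using p q eq
    by (intro inj_onD[of "\<rho> c" "{r \<in> E. fst r = fst p}" p q])
      (simp_all add: dom_lift_chart map_lift_chart)
qed

lemma chart_inv_lift_chart:
  "c \<in> A \<Longrightarrow> p \<in> chart_dom (lift_chart c) \<Longrightarrow> chart_inv (lift_chart c) (chart_map (lift_chart c) p) = p"
  unfolding chart_inv_def by (intro inv_into_f_f inj_on_lift_chart)

text \<open>A coordinate change of the total space sends \<open>(y, m)\<close> to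
  \<open>(transition c d y, L c d y m)\<close> on a product of open sets, so its smoothness is that
  of the base transitions and of \<open>L\<close>.\<close>

lemma smooth_atlas_lift: "smooth_atlas lift_atlas"
  unfolding smooth_atlas_def
proof (intro conjI ballI)
  fix k assume "k \<in> lift_atlas"
  then obtain c where c: "c \<in> A" "k = lift_chart c" by (auto simp: lift_atlas_def)
  show "inj_on (chart_map k) (chart_dom k)" using c inj_on_lift_chart by simp
  show "open (chart_map k ` chart_dom k)"
    unfolding c(2) lift_chart_range[OF c(1)]
      by (intro open_Times open_chart_image[OF A c(1)] open_F)
  fix l assume "l \<in> lift_atlas"
  then obtain d where d: "d \<in> A" "l = lift_chart d" by (auto simp: lift_atlas_def)
  let ?O = "chart_map c ` (chart_dom c \<inter> chart_dom d)"
  have O: "chart_map k ` (chart_dom k \<inter> chart_dom l) = ?O \<times> F"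
    using lift_chart_overlap[OF c(1)] c d by simp
  have open_O: "open (?O \<times> F)" by (intro open_Times open_overlap[OF A c(1) d(1)] open_F)
  then show "open (chart_map k ` (chart_dom k \<inter> chart_dom l))" using O by simp
  have "smooth_on (?O \<times> F) (\<lambda>z. (transition c d (fst z), L c d (fst z) (snd z)))"
    by (intro smooth_on_Pair[OF open_O] smooth_L c d
        smooth_on_compose[OF open_O smooth_on_fst[OF open_O] smooth_on_transition[OF A c(1) d(1)]])
          auto
  then have "smooth_on (?O \<times> F) (transition k l)"
  proof (rule smooth_on_cong[OF open_O, rotated])
    fix z assume "z \<in> ?O \<times> F"
    then have "z \<in> chart_map k ` (chart_dom k \<inter> chart_dom l)" using O by simp
    then obtain p where p: "p \<in> chart_dom k" "p \<in> chart_dom l" "z = chart_map k p" by blast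
    then have "p \<in> E" "c \<in> charts_at A (fst p)" "d \<in> charts_at A (fst p)"
      using c d by (auto simp: dom_lift_chart charts_at_def)
    with p show "(transition c d (fst z), L c d (fst z) (snd z)) = transition k l z"
      using c d chart_inv_lift_chart[OF c(1), of p] trans[of p c d]
        transition_chart_map[OF A c(1), of "fst p" d]
      by (simp add: transition_def[of "lift_chart c" "lift_chart d"] map_lift_chart charts_at_def)
  qed
  then show "smooth_on (chart_map k ` (chart_dom k \<inter> chart_dom l)) (transition k l)" using O by simp
qed

lemma points_lift_atlas: "points lift_atlas = E"
  using base by (force simp: points_def lift_atlas_def dom_lift_chart)

lemma charts_at_lift_atlas: "p \<in> E \<Longrightarrow> charts_at lift_atlas p = lift_chart ` charts_at A (fst p)"
  by (auto simp: charts_at_def lift_atlas_def dom_lift_chart)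

lemma chart_exists:
  assumes "p \<in> E" obtains c where "c \<in> charts_at A (fst p)"
  using base[OF assms] that unfolding points_def charts_at_def by blast

lemma lift_chart_at: "p \<in> E \<Longrightarrow> c \<in> charts_at A (fst p) \<Longrightarrow> lift_chart c \<in> charts_at lift_atlas p"
  using charts_at_lift_atlas by simp

text \<open>In lifted coordinates the projection is the linear map \<open>fst\<close>, which is its
  own derivative.\<close>

lemma tangent_map_fst:
  assumes p: "p \<in> E" and c: "c \<in> charts_at A (fst p)" and v: "v \<in> tangent_space lift_atlas p"
  shows "tangent_map lift_atlas A fst (p, v) =
    (fst p, coord_vector A c (fst p) (fst (v (lift_chart c))))"
proof (rule tangent_map_coords[OF smooth_atlas_lift A lift_chart_at[OF p c] _ v])
  have cA: "c \<in> A" using c by (simp add: charts_at_def)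
  show "c \<in> A" by (fact cA)
  show "open (chart_map c ` chart_dom c \<times> F)" by (intro open_Times open_chart_image[OF A cA] open_F)
  show "chart_map (lift_chart c) p \<in> chart_map c ` chart_dom c \<times> F"
    using c p lift_chart_range[OF cA] by (auto simp: charts_at_def dom_lift_chart)
  show "chart_map c ` chart_dom c \<times> F \<subseteq> chart_map (lift_chart c) ` chart_dom (lift_chart c)"
    using lift_chart_range[OF cA] by simp
  show "(fst has_derivative fst) (at (chart_map (lift_chart c) p))"
    by (rule has_derivative_fst[OF has_derivative_ident])
qed (auto simp: dom_lift_chart map_lift_chart)

section \<open>The vertical bundle and its complements\<close>

abbreviation vertical_bundle where "vertical_bundle \<equiv> kernel_bundle lift_atlas A fst"

lemma vertical_bundle_subset: "vertical_bundle \<subseteq> tangent_bundle lift_atlas"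
  by (auto simp: kernel_bundle_def)

lemma in_vertical_bundle:
  assumes p: "p \<in> E" and c: "c \<in> charts_at A (fst p)"
  shows "(p, v) \<in> vertical_bundle \<longleftrightarrow> v \<in> tangent_space lift_atlas p \<and> fst (v (lift_chart c)) = 0"
proof -
  have "coord_vector A c (fst p) e = 0 \<longleftrightarrow> e = 0" for e
    using linear_0[OF linear_coord_vector[OF A c]] inj_coord_vector[OF A c] by (metis injD)
  moreover have "(p, v) \<in> vertical_bundle \<longleftrightarrow>
      v \<in> tangent_space lift_atlas p \<and> snd (tangent_map lift_atlas A fst (p, v)) = 0"
    using p by (simp add: kernel_bundle_def tangent_bundle_def points_lift_atlas)
  ultimately show ?thesis
    using tangent_map_fst[OF p c, of v] by (cases "v \<in> tangent_space lift_atlas p") simp_all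
qed

text \<open>Vanishing of the first component is the only constraint, because \<open>F\<close> is
  open and every second component is the component of a tangent vector.\<close>

lemma chart_fibre_vertical:
  assumes p: "p \<in> E" and c: "c \<in> charts_at A (fst p)"
  shows "chart_fibre vertical_bundle (lift_chart c) p = {0} \<times> UNIV"
proof
  show "chart_fibre vertical_bundle (lift_chart c) p \<subseteq> {0} \<times> UNIV"
  proof
    fix z assume "z \<in> chart_fibre vertical_bundle (lift_chart c) p"
    then obtain v where "(p, v) \<in> vertical_bundle" "z = v (lift_chart c)" unfolding chart_fibre_def
      by blast
    then show "z \<in> {0} \<times> UNIV" using in_vertical_bundle[OF p c, of v] by (simp add: mem_Times_iff)
  qed
  show "{0} \<times> UNIV \<subseteq> chart_fibre vertical_bundle (lift_chart c) p"
  proof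
    fix z :: "'e \<times> 'f" assume z: "z \<in> {0} \<times> UNIV"
    note k = lift_chart_at[OF p c]
    have "(p, coord_vector lift_atlas (lift_chart c) p z) \<in> vertical_bundle"
      using z coord_vector_in_tangent_space[OF smooth_atlas_lift k]
        coord_vector_apply[OF smooth_atlas_lift k]
      by (auto simp: in_vertical_bundle[OF p c])
    then show "z \<in> chart_fibre vertical_bundle (lift_chart c) p"
      unfolding chart_fibre_def using coord_vector_apply[OF smooth_atlas_lift k]
      by (intro image_eqI[of _ _ "coord_vector lift_atlas (lift_chart c) p z"]) auto
  qed
qed

text \<open>Local frames need to be localised only in the base: both frames constructed below are
  defined over a whole product \<open>V \<times> F\<close>, with formulas valid for every fibre
  coordinate.\<close>

lemma smooth_subbundle_lift:
  assumes "D \<subseteq> tangent_bundle lift_atlas"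
    and "\<And>x c. c \<in> charts_at A x \<Longrightarrow> \<exists>V (k::nat) Z.
      open V \<and> chart_map c x \<in> V \<and> V \<subseteq> chart_map c ` chart_dom c \<and>
      (\<forall>i<k. smooth_on (V \<times> F) (Z i)) \<and>
      (\<forall>p\<in>E. fst p \<in> chart_dom c \<and> chart_map c (fst p) \<in> V \<longrightarrow>
         inj_on (\<lambda>i. Z i (chart_map (lift_chart c) p)) {..<k} \<and>
         independent ((\<lambda>i. Z i (chart_map (lift_chart c) p)) ` {..<k}) \<and>
         span ((\<lambda>i. Z i (chart_map (lift_chart c) p)) ` {..<k}) = chart_fibre D (lift_chart c) p)"
  shows "smooth_subbundle lift_atlas D"
proof (rule smooth_subbundleI[OF smooth_atlas_lift assms(1)])
  fix p assume "p \<in> points lift_atlas"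
  then have p: "p \<in> E" using points_lift_atlas by simp
  then obtain c where c: "c \<in> charts_at A (fst p)" using chart_exists by blast
  have cA: "c \<in> A" using c by (simp add: charts_at_def)
  from assms(2)[OF c] obtain V and k :: nat and Z where
    V: "open V" "chart_map c (fst p) \<in> V" "V \<subseteq> chart_map c ` chart_dom c"
    and Z: "\<forall>i<k. smooth_on (V \<times> F) (Z i)"
    and *: "\<forall>p\<in>E. fst p \<in> chart_dom c \<and> chart_map c (fst p) \<in> V \<longrightarrow>
         inj_on (\<lambda>i. Z i (chart_map (lift_chart c) p)) {..<k} \<and>
         independent ((\<lambda>i. Z i (chart_map (lift_chart c) p)) ` {..<k}) \<and>
         span ((\<lambda>i. Z i (chart_map (lift_chart c) p)) ` {..<k}) = chart_fibre D (lift_chart c) p"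
    by - (elim exE conjE, rule that)
  have "open (V \<times> F)" by (intro open_Times V open_F)
  moreover have "chart_map (lift_chart c) p \<in> V \<times> F"
    using V rho_in_F[OF p c] by (simp add: map_lift_chart)
  moreover have "V \<times> F \<subseteq> chart_map (lift_chart c) ` chart_dom (lift_chart c)"
    unfolding lift_chart_range[OF cA] using V by auto
  moreover have "\<forall>q\<in>chart_dom (lift_chart c). chart_map (lift_chart c) q \<in> V \<times> F \<longrightarrow>
      inj_on (\<lambda>i. Z i (chart_map (lift_chart c) q)) {..<k} \<and>
      independent ((\<lambda>i. Z i (chart_map (lift_chart c) q)) ` {..<k}) \<and>
      span ((\<lambda>i. Z i (chart_map (lift_chart c) q)) ` {..<k}) = (\<lambda>v. v (lift_chart c)) ` (D `` {q})"
  proof (intro ballI impI)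
    fix q assume "q \<in> chart_dom (lift_chart c)" "chart_map (lift_chart c) q \<in> V \<times> F"
    then have "q \<in> E" "fst q \<in> chart_dom c \<and> chart_map c (fst q) \<in> V"
      by (simp_all add: dom_lift_chart map_lift_chart)
    from *[THEN bspec, OF this(1), THEN mp, OF this(2)]
    show "inj_on (\<lambda>i. Z i (chart_map (lift_chart c) q)) {..<k} \<and>
      independent ((\<lambda>i. Z i (chart_map (lift_chart c) q)) ` {..<k}) \<and>
      span ((\<lambda>i. Z i (chart_map (lift_chart c) q)) ` {..<k}) = (\<lambda>v. v (lift_chart c)) ` (D `` {q})"
      unfolding chart_fibre_def .
  qed
  ultimately show "\<exists>l U (k::nat) Z. l \<in> charts_at lift_atlas p \<and> open U \<and> chart_map l p \<in> U \<and>
      U \<subseteq> chart_map l ` chart_dom l \<and> (\<forall>i<k. smooth_on U (Z i)) \<and>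
      (\<forall>q\<in>chart_dom l. chart_map l q \<in> U \<longrightarrow>
         inj_on (\<lambda>i. Z i (chart_map l q)) {..<k} \<and>
         independent ((\<lambda>i. Z i (chart_map l q)) ` {..<k}) \<and>
         span ((\<lambda>i. Z i (chart_map l q)) ` {..<k}) = (\<lambda>v. v l) ` (D `` {q}))"
    using lift_chart_at[OF p c] Z
    by - (rule exI[of _ "lift_chart c"], rule exI[of _ "V \<times> F"], rule exI[of _ k], rule exI[of _ Z],
      intro conjI)
qed

text \<open>In each lifted chart the constant fields \<open>(0, b)\<close>, with \<open>b\<close>
  from the standard basis of the fibre space, are a frame.\<close>

lemma smooth_subbundle_vertical: "smooth_subbundle lift_atlas vertical_bundle"
proof (rule smooth_subbundle_lift[OF vertical_bundle_subset])
  fix x c assume c: "c \<in> charts_at A x"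
  then have cA: "c \<in> A" "x \<in> chart_dom c" by (auto simp: charts_at_def)
  let ?k = "card (Basis :: 'f set)"
  obtain b where b: "bij_betw b {..<?k} (Basis :: 'f set)"
    using ex_bij_betw_nat_finite[of "Basis :: 'f set"] by (auto simp: atLeast0LessThan)
  let ?Z = "\<lambda>i. (0 :: 'e, b i)"
  let ?j = "\<lambda>y. (0 :: 'e, y :: 'f)"
  have im: "?Z ` {..<?k} = ?j ` Basis"
  proof -
    have "?Z ` {..<?k} = ?j ` b ` {..<?k}" by (simp only: image_image)
    then show ?thesis using b by (simp add: bij_betw_def)
  qed
  have lin: "linear ?j" by (rule linearI) auto
  have inj: "inj ?j" by (rule injI) simp
  have "inj_on ?Z {..<?k}" using b by (auto simp: bij_betw_def inj_on_def)
  moreover have "independent (?Z ` {..<?k})"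
    unfolding im using linear_independent_injective_image[OF lin independent_Basis] inj
      inj_on_subset by blast
  moreover have "span (?Z ` {..<?k}) = {0} \<times> UNIV"
    unfolding im linear_span_image[OF lin] by auto
  moreover have "chart_fibre vertical_bundle (lift_chart c) p = {0} \<times> UNIV"
    if "p \<in> E" "fst p \<in> chart_dom c" for p
    using that cA by (intro chart_fibre_vertical) (auto simp: charts_at_def)
  ultimately show "\<exists>V (k::nat) Z.
      open V \<and> chart_map c x \<in> V \<and> V \<subseteq> chart_map c ` chart_dom c \<and>
      (\<forall>i<k. smooth_on (V \<times> F) (Z i)) \<and>
      (\<forall>p\<in>E. fst p \<in> chart_dom c \<and> chart_map c (fst p) \<in> V \<longrightarrow>
         inj_on (\<lambda>i. Z i (chart_map (lift_chart c) p)) {..<k} \<and>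
         independent ((\<lambda>i. Z i (chart_map (lift_chart c) p)) ` {..<k}) \<and>
         span ((\<lambda>i. Z i (chart_map (lift_chart c) p)) ` {..<k}) =
           chart_fibre vertical_bundle (lift_chart c) p)"
    using cA open_chart_image[OF A cA(1)]
    by (intro exI[of _ "chart_map c ` chart_dom c"] exI[of _ ?k] exI[of _ "\<lambda>i _. ?Z i"])
      (auto intro!: smooth_on_const open_Times open_F)
qed

lemma chart_fibreD:
  assumes D: "D \<subseteq> tangent_bundle lift_atlas" and p: "p \<in> E" and c: "c \<in> charts_at A (fst p)"
    and z: "z \<in> chart_fibre D (lift_chart c) p"
  shows "(p, coord_vector lift_atlas (lift_chart c) p z) \<in> D"
  using z fibre_eq_coord_image[OF smooth_atlas_lift D lift_chart_at[OF p c]]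
  unfolding chart_fibre_def by blast

text \<open>Vertical vectors are those with first component 0. Hence trivial intersection with the
  vertical bundle is injectivity of \<open>fst\<close> on the fibre, and generating the tangent
  space together with it is surjectivity.\<close>

lemma splitting_fst_bij:
  assumes spl: "smooth_splitting lift_atlas vertical_bundle D" and p: "p \<in> E"
    and c: "c \<in> charts_at A (fst p)"
  shows "bij_betw fst (chart_fibre D (lift_chart c) p) UNIV"
proof -
  let ?k = "lift_chart c"
  note k = lift_chart_at[OF p c]
  have pp: "p \<in> points lift_atlas" using p points_lift_atlas by simp
  have sub: "smooth_subbundle lift_atlas D"
    and zero: "vertical_bundle `` {p} \<inter> D `` {p} = {0}"
    and sum: "{v + w | v w. v \<in> vertical_bundle `` {p} \<and> w \<in> D `` {p}} = tangent_space lift_atlas p"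
    using spl pp unfolding smooth_splitting_def by auto
  have D: "D \<subseteq> tangent_bundle lift_atlas" using sub by (simp add: smooth_subbundle_def)
  have S: "subspace (chart_fibre D ?k p)"
    using smooth_subbundle_fibre_subspace[OF sub pp] by (rule subspace_chart_fibre)
  have "inj_on fst (chart_fibre D ?k p)"
  proof (rule inj_onI)
    fix z w assume z: "z \<in> chart_fibre D ?k p" and w: "w \<in> chart_fibre D ?k p"
      and eq: "fst z = fst w"
    have zw: "z - w \<in> chart_fibre D ?k p" using S z w by (rule subspace_diff)
    let ?v = "coord_vector lift_atlas ?k p (z - w)"
    have "(p, ?v) \<in> D" using chart_fibreD[OF D p c zw] .
    moreover have "(p, ?v) \<in> vertical_bundle"
      unfolding in_vertical_bundle[OF p c] using eq k
      by (simp add: coord_vector_in_tangent_space[OF smooth_atlas_lift]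
        coord_vector_apply[OF smooth_atlas_lift])
    ultimately have "?v = 0" using zero by auto
    then have "?v ?k = 0" by simp
    then show "z = w" by (simp add: coord_vector_apply[OF smooth_atlas_lift k])
  qed
  moreover have "e \<in> fst ` chart_fibre D ?k p" for e
  proof -
    \<comment> \<open>The second component 0 is an arbitrary choice: removing the vertical part
      leaves a vector of \<open>D\<close> that still has first component \<open>e\<close>.\<close>
    have "coord_vector lift_atlas ?k p (e, 0) \<in> tangent_space lift_atlas p"
      by (rule coord_vector_in_tangent_space[OF smooth_atlas_lift k])
    then obtain v w where vw: "coord_vector lift_atlas ?k p (e, 0) = v + w"
      "(p, v) \<in> vertical_bundle" "(p, w) \<in> D" using sum by blast
    have "(e, 0) = v ?k + w ?k"
      using coord_vector_apply[OF smooth_atlas_lift k, of "(e, 0)"] vw(1) by simp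
    moreover have "fst (v ?k) = 0" using vw(2) in_vertical_bundle[OF p c] by blast
    ultimately have "fst (w ?k) = e" by (metis add_0 fst_add fst_conv)
    then show ?thesis using chart_fibreI[OF vw(3)] by blast
  qed
  ultimately show ?thesis by (auto simp: bij_betw_def)
qed

text \<open>The converse of \<open>splitting_fst_bij\<close>. The vertical bundle is always smooth,
  so only the complement has to be supplied.\<close>

lemma splittingI:
  assumes sub: "smooth_subbundle lift_atlas D"
    and bij: "\<And>p c. p \<in> E \<Longrightarrow> c \<in> charts_at A (fst p) \<Longrightarrow>
      bij_betw fst (chart_fibre D (lift_chart c) p) UNIV"
  shows "smooth_splitting lift_atlas D vertical_bundle"
  unfolding smooth_splitting_def
proof (intro conjI ballI sub smooth_subbundle_vertical)
  fix p assume pp: "p \<in> points lift_atlas"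
  then have p: "p \<in> E" using points_lift_atlas by simp
  then obtain c where c: "c \<in> charts_at A (fst p)" using chart_exists by blast
  let ?k = "lift_chart c"
  note k = lift_chart_at[OF p c]
  have D: "D \<subseteq> tangent_bundle lift_atlas" using sub by (simp add: smooth_subbundle_def)
  have SD: "subspace (D `` {p})" by (rule smooth_subbundle_fibre_subspace[OF sub pp])
  have SV: "subspace (vertical_bundle `` {p})"
    by (rule smooth_subbundle_fibre_subspace[OF smooth_subbundle_vertical pp])
  have DT: "D `` {p} \<subseteq> tangent_space lift_atlas p" using D by (auto simp: tangent_bundle_def)
  have VT: "vertical_bundle `` {p} \<subseteq> tangent_space lift_atlas p"
    using vertical_bundle_subset by (auto simp: tangent_bundle_def)
  note TS = subspace_tangent_space[OF smooth_atlas_lift k]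
  note bp = bij[OF p c]
  have "v = 0" if v: "(p, v) \<in> D" "(p, v) \<in> vertical_bundle" for v
  proof -
    have "fst (v ?k) = 0" using v in_vertical_bundle[OF p c] by blast
    moreover have "v ?k \<in> chart_fibre D ?k p" by (rule chart_fibreI[OF v(1)])
    moreover have "0 \<in> chart_fibre D ?k p" using subspace_0[OF subspace_chart_fibre[OF SD]] .
    ultimately have "v ?k = 0" using bp by (metis bij_betw_def inj_onD fst_zero)
    then show ?thesis
      using tangent_vector_eqI[OF smooth_atlas_lift k, of v 0] subspace_0[OF TS] DT v by auto
  qed
  then show "D `` {p} \<inter> vertical_bundle `` {p} = {0}"
    using subspace_0[OF SD] subspace_0[OF SV] by auto
  show "{v + w | v w. v \<in> D `` {p} \<and> w \<in> vertical_bundle `` {p}} = tangent_space lift_atlas p"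
  proof
    show "{v + w | v w. v \<in> D `` {p} \<and> w \<in> vertical_bundle `` {p}} \<subseteq> tangent_space lift_atlas p"
      using DT VT subspace_add[OF TS] by blast
    show "tangent_space lift_atlas p \<subseteq> {v + w | v w. v \<in> D `` {p} \<and> w \<in> vertical_bundle `` {p}}"
    proof
      fix u assume u: "u \<in> tangent_space lift_atlas p"
      \<comment> \<open>The part of \<open>u\<close> in \<open>D\<close> is the vector of
        \<open>D\<close> with the same first component; the difference is then vertical.\<close>
      have "fst (u ?k) \<in> fst ` chart_fibre D ?k p" using bp by (auto simp: bij_betw_def)
      then obtain v where v: "(p, v) \<in> D" "fst (u ?k) = fst (v ?k)" unfolding chart_fibre_def
        by auto
      have "u - v \<in> tangent_space lift_atlas p" using subspace_diff[OF TS u] v DT by blast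
      moreover have "fst ((u - v) ?k) = 0" using v by simp
      ultimately have "(p, u - v) \<in> vertical_bundle" using in_vertical_bundle[OF p c] by blast
      then have "v \<in> D `` {p} \<and> u - v \<in> vertical_bundle `` {p}" using v by blast
      moreover have "u = v + (u - v)" by simp
      ultimately show "u \<in> {v + w | v w. v \<in> D `` {p} \<and> w \<in> vertical_bundle `` {p}}" by blast
    qed
  qed
qed

text \<open>In a chart the equation for the differential says that the first component of
  \<open>h\<close> is the component of \<open>v\<close>, and bijectivity of \<open>fst\<close> on
  the fibre leaves exactly one such \<open>h\<close>.\<close>

lemma unique_lift:
  assumes D: "D \<subseteq> tangent_bundle lift_atlas" and p: "p \<in> E" and c: "c \<in> charts_at A (fst p)"
    and bij: "bij_betw fst (chart_fibre D (lift_chart c) p) UNIV"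
    and v: "v \<in> tangent_space A (fst p)"
  shows "\<exists>!h. h \<in> D `` {p} \<and> tangent_map lift_atlas A fst (p, h) = (fst p, v)"
proof -
  let ?k = "lift_chart c"
  note k = lift_chart_at[OF p c]
  have iff: "tangent_map lift_atlas A fst (p, h) = (fst p, v) \<longleftrightarrow> fst (h ?k) = v c"
    if "h \<in> D `` {p}" for h
  proof -
    have "h \<in> tangent_space lift_atlas p" using that D by (auto simp: tangent_bundle_def)
    from tangent_map_fst[OF p c this] show ?thesis
      using coord_vector_component[OF A c v] coord_vector_apply[OF A c] by (metis prod.inject)
  qed
  have "v c \<in> fst ` chart_fibre D ?k p" using bij by (auto simp: bij_betw_def)
  then obtain h where h: "h \<in> D `` {p}" "fst (h ?k) = v c" unfolding chart_fibre_def by auto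
  moreover have "h' = h" if h': "h' \<in> D `` {p}" "fst (h' ?k) = v c" for h'
  proof -
    have "h' ?k = h ?k"
      using bij h h' chart_fibreI[of p _ D ?k] by (auto simp: bij_betw_def inj_on_def)
    then show ?thesis
      using tangent_vector_eqI[OF smooth_atlas_lift k, of h' h] h h' D
        by (auto simp: tangent_bundle_def)
  qed
  ultimately show ?thesis using iff by blast
qed

end

section \<open>Matrices\<close>

lemma matrix_inv_works:
  fixes M :: "real ^ 'n ^ 'n"
  assumes "invertible M"
  shows "M ** matrix_inv M = mat 1" "matrix_inv M ** M = mat 1"
  using assms someI_ex[of "\<lambda>M'. M ** M' = mat 1 \<and> M' ** M = mat 1"]
  unfolding invertible_def matrix_inv_def by auto

lemma invertible_matrix_inv: "invertible (M :: real ^ 'n ^ 'n) \<Longrightarrow> invertible (matrix_inv M)"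
  using matrix_inv_works invertible_def by blast

lemma invertible_mat_1: "invertible (mat 1 :: real ^ 'n ^ ('n::finite))"
  unfolding invertible_def by (intro exI[of _ "mat 1"]) simp

lemma bilinear_matrix_mult:
  "bilinear ((**) :: real ^ 'n ^ 'm \<Rightarrow> real ^ 'p ^ 'n \<Rightarrow> real ^ 'p ^ 'm)"
  unfolding bilinear_def linear_iff
  by (auto simp: matrix_matrix_mult_def vec_eq_iff sum.distrib algebra_simps sum_distrib_left)

lemma linear_transpose: "linear (transpose :: real ^ 'n ^ 'm \<Rightarrow> real ^ 'm ^ 'n)"
  by (rule linearI) (auto simp: transpose_def vec_eq_iff)

lemma inner_matrix_vector: "(A *v x) \<bullet> (B *v y) = x \<bullet> ((transpose A ** B) *v y)"
  for A B :: "real ^ 'n ^ 'n"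
  by (metis dot_lmul_matrix matrix_vector_mul_assoc transpose_transpose vector_transpose_matrix)

section \<open>Differentiability of the determinant and of the matrix inverse\<close>

lemma differentiable_prod_real:
  fixes f :: "'i \<Rightarrow> 'e::real_normed_vector \<Rightarrow> real"
  assumes "\<And>i. i \<in> I \<Longrightarrow> f i differentiable (at x)"
  shows "(\<lambda>x. \<Prod>i\<in>I. f i x) differentiable (at x)"
  using assms by (induction I rule: infinite_finite_induct) auto

lemma differentiable_det:
  fixes M :: "'e::real_normed_vector \<Rightarrow> real ^ 'n ^ 'n"
  assumes "\<And>i j. (\<lambda>x. M x $ i $ j) differentiable (at x)"
  shows "(\<lambda>x. det (M x)) differentiable (at x)"
  unfolding det_def
  by (intro differentiable_sum ballI differentiable_mult differentiable_prod_real
    differentiable_const assms)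
    (simp add: finite_permutations)

lemma differentiable_matrix_entry: "(\<lambda>M :: real ^ 'n ^ 'm. M $ i $ j) differentiable (at M)"
  by (intro bounded_linear_imp_differentiable
    bounded_linear_compose[OF bounded_linear_vec_nth bounded_linear_vec_nth])

lemma open_invertible: "open {M :: real ^ 'n ^ 'n. invertible M}"
proof -
  have "continuous_on UNIV (det :: real ^ 'n ^ 'n \<Rightarrow> real)"
    by (intro continuous_at_imp_continuous_on ballI differentiable_imp_continuous_within
        differentiable_det differentiable_matrix_entry)
  then have "open (det -` (- {0}) :: (real ^ 'n ^ 'n) set)"
    by (intro open_vimage) auto
  moreover have "det -` (- {0}) = {M :: real ^ 'n ^ 'n. invertible M}"
    by (auto simp: invertible_det_nz)
  ultimately show ?thesis by simp
qed

text \<open>Cramer's rule writes the entries of the inverse as quotients of determinants, valid on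
  the open set of invertible matrices and hence near \<open>M\<close>.\<close>

lemma matrix_inv_differentiable:
  fixes M :: "real ^ 'n ^ 'n"
  assumes "invertible M"
  shows "matrix_inv differentiable (at M)"
proof -
  \<comment> \<open>\<open>C k j A\<close> is \<open>A\<close> with column \<open>k\<close> replaced
    by the \<open>j\<close>-th unit vector: the numerator in Cramer's rule for the system
    \<open>A *v x = axis j 1\<close>.\<close>
  define C :: "'n \<Rightarrow> 'n \<Rightarrow> real ^ 'n ^ 'n \<Rightarrow> real ^ 'n ^ 'n"
    where "C k j A = (\<chi> i l. if l = k then axis j 1 $ i else A $ i $ l)" for k j A
  have entry: "matrix_inv A $ k $ j = det (C k j A) / det A" if "invertible A"
    for A :: "real ^ 'n ^ 'n" and k j
  proof -
    have "A *v (matrix_inv A *v axis j 1) = axis j 1"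
      by (simp add: matrix_vector_mul_assoc matrix_inv_works[OF that])
    then have "matrix_inv A *v axis j 1 = (\<chi> k. det (C k j A) / det A)"
      using cramer[of A] that unfolding invertible_det_nz C_def by blast
    then show ?thesis by (simp add: matrix_vector_mult_basis column_def vec_eq_iff)
  qed
  have C: "(\<lambda>A. C k j A $ i $ l) differentiable (at M)" for k j i l
    by (cases "l = k") (simp_all add: C_def differentiable_matrix_entry)
  have D: "(\<lambda>A. \<chi> k j. det (C k j A) / det A) differentiable (at M)"
  proof (subst differentiable_componentwise_within, rule ballI)
    fix b :: "real ^ 'n ^ 'n" assume "b \<in> Basis"
    then obtain k j where b: "b = axis k (axis j 1)" by (auto simp: Basis_vec_def)
    have "(\<lambda>A. det (C k j A) / det A) differentiable (at M)"
      using assms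
      by (intro differentiable_divide differentiable_det C differentiable_matrix_entry)
        (simp add: invertible_det_nz)
    then show "(\<lambda>A. (\<chi> k j. det (C k j A) / det A) \<bullet> b) differentiable (at M)"
      by (simp add: b inner_axis)
  qed
  have "(\<chi> k j. det (C k j A) / det A) = matrix_inv A" if "A \<in> {M. invertible M}" for A
    using that entry by (simp add: vec_eq_iff)
  with D[unfolded frechet_derivative_works] assms show ?thesis
    using has_derivative_transform_within_open[OF _ open_invertible] differentiableI by blast
qed

text \<open>Differentiate \<open>A ** matrix_inv A = mat 1\<close>, which holds near
  \<open>M\<close>, and solve for the derivative of the inverse.\<close>

lemma has_derivative_matrix_inv:
  fixes M :: "real ^ 'n ^ 'n"
  assumes M: "invertible M"
  shows "(matrix_inv has_derivative (\<lambda>W. - (matrix_inv M ** W ** matrix_inv M))) (at M)"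
proof -
  let ?D = "frechet_derivative matrix_inv (at M)"
  have D: "(matrix_inv has_derivative ?D) (at M)"
    using matrix_inv_differentiable[OF M] by (simp add: frechet_derivative_works)
  have "((\<lambda>A. A ** matrix_inv A) has_derivative (\<lambda>W. M ** ?D W + W ** matrix_inv M)) (at M)"
    using bilinear_matrix_mult[unfolded bilinear_conv_bounded_bilinear]
    by (rule bounded_bilinear.FDERIV) (auto intro: has_derivative_ident D)
  then have "((\<lambda>A. mat 1) has_derivative (\<lambda>W. M ** ?D W + W ** matrix_inv M)) (at M)"
    by (rule has_derivative_transform_within_open[OF _ open_invertible])
      (auto simp: M matrix_inv_works)
  then have zero: "M ** ?D W + W ** matrix_inv M = 0" for W
    using fun_cong[OF has_derivative_unique[OF _ has_derivative_const]] by blast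
  have "?D = (\<lambda>W. - (matrix_inv M ** W ** matrix_inv M))"
  proof
    fix W
    have "matrix_inv M ** (M ** ?D W + W ** matrix_inv M) = 0"
      unfolding zero by (simp add: matrix_matrix_mult_def vec_eq_iff)
    then have "?D W + matrix_inv M ** W ** matrix_inv M = 0"
      by (simp add: matrix_add_ldistrib matrix_mul_assoc matrix_inv_works[OF M])
    then show "?D W = - (matrix_inv M ** W ** matrix_inv M)" by (simp add: eq_neg_iff_add_eq_0)
  qed
  with D show ?thesis by simp
qed

section \<open>Positive definite matrices as Gram matrices\<close>

definition pos_def :: "real ^ 'n ^ 'n \<Rightarrow> bool"
  where "pos_def S \<longleftrightarrow> (\<forall>v. v \<noteq> 0 \<longrightarrow> 0 < v \<bullet> (S *v v))"

text \<open>A maximal orthonormal set for the inner product given by \<open>S\<close> is a basis.\<close>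

lemma pos_def_orthonormal_frame:
  fixes S :: "real ^ 'n ^ 'n"
  assumes sym: "transpose S = S" and pos: "pos_def S"
  shows "\<exists>m :: real ^ 'n ^ 'n. invertible m \<and> transpose m ** S ** m = mat 1"
proof -
  define B where "B v w = v \<bullet> (S *v w)" for v w
  have B_sym: "B v w = B w v" for v w
    unfolding B_def by (metis dot_lmul_matrix inner_commute sym vector_transpose_matrix)
  have B_lin: "linear (B v)" for v
    unfolding B_def by (rule linearI)
      (auto simp: matrix_vector_right_distrib inner_add_right matrix_vector_mult_scaleR)
  define ON where "ON Q \<longleftrightarrow> (\<forall>v\<in>Q. \<forall>w\<in>Q. B v w = (if v = w then 1 else 0))" for Q
  have coeff: "B v (\<Sum>w\<in>Q. c w *\<^sub>R w) = c v" if "finite Q" "ON Q" "v \<in> Q" for Q c v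
  proof -
    have "B v (\<Sum>w\<in>Q. c w *\<^sub>R w) = (\<Sum>w\<in>Q. c w * B v w)"
      by (simp add: linear_sum[OF B_lin] linear_scale[OF B_lin])
    also have "\<dots> = (\<Sum>w\<in>Q. if v = w then c w else 0)"
      using that by (intro sum.cong) (auto simp: ON_def)
    also have "\<dots> = c v" using that by simp
    finally show ?thesis .
  qed
  have indep: "independent Q" if "finite Q" "ON Q" for Q
    unfolding independent_explicit_finite_subsets
  proof (intro allI impI ballI)
    fix T c v assume "T \<subseteq> Q" "finite T" "(\<Sum>v\<in>T. c v *\<^sub>R v) = 0" "v \<in> T"
    moreover from this have "ON T" using that(2) unfolding ON_def by blast
    ultimately show "c v = 0" using coeff[of T v c] linear_0[OF B_lin] by simp
  qed
  \<comment> \<open>Independence of orthonormal sets bounds their size by the dimension, so that a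
    largest one exists.\<close>
  have bound: "card Q \<le> CARD('n)" if "finite Q" "ON Q" for Q
    using independent_card_le[OF indep[OF that]] by simp
  define P where "P k \<longleftrightarrow> (\<exists>Q. finite Q \<and> ON Q \<and> card Q = k)" for k
  have "P 0" unfolding P_def by (intro exI[of _ "{}"]) (simp add: ON_def)
  moreover have "\<forall>k. P k \<longrightarrow> k \<le> CARD('n)" unfolding P_def using bound by blast
  ultimately have "P (Greatest P)" "\<And>k. P k \<Longrightarrow> k \<le> Greatest P"
    using GreatestI_nat Greatest_le_nat by blast+
  then obtain Q where Q: "finite Q" "ON Q" and max: "\<And>R. finite R \<Longrightarrow> ON R \<Longrightarrow> card R \<le> card Q"
    unfolding P_def by metis
  have span: "span Q = UNIV"
  proof (rule ccontr)
    assume "span Q \<noteq> UNIV"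
    then obtain x where x: "x \<notin> span Q" by blast
    \<comment> \<open>A Gram-Schmidt step: \<open>x\<close> minus its \<open>B\<close>-orthogonal
      projection to the span of \<open>Q\<close>. Normalised, it would enlarge the maximal set
      \<open>Q\<close>.\<close>
    define y where "y = x - (\<Sum>w\<in>Q. B w x *\<^sub>R w)"
    have "(\<Sum>w\<in>Q. B w x *\<^sub>R w) \<in> span Q" by (intro span_sum span_scale span_base)
    then have "y \<noteq> 0" using x by (auto simp: y_def)
    then have pos_y: "B y y > 0" using pos by (simp add: pos_def_def B_def)
    have orth: "B v y = 0" if "v \<in> Q" for v
      using coeff[OF Q that, of "\<lambda>w. B w x"] by (simp add: y_def linear_diff[OF B_lin])
    define z where "z = (1 / sqrt (B y y)) *\<^sub>R y"
    have "B z z = (1 / sqrt (B y y)) * ((1 / sqrt (B y y)) * B y y)"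
      unfolding z_def linear_scale[OF B_lin] B_sym[of "_ *\<^sub>R y" y] by simp
    then have zz: "B z z = 1" using pos_y by (simp add: field_simps)
    have orth_z: "B v z = 0" if "v \<in> Q" for v
      using orth[OF that] by (simp add: z_def linear_scale[OF B_lin])
    then have "z \<notin> Q" using zz by force
    have "B z v = 0" if "v \<in> Q" for v
      using orth_z[OF that] B_sym[of z v] by simp
    then have "ON (insert z Q)"
      using Q(2) zz orth_z \<open>z \<notin> Q\<close> by (auto simp: ON_def)
    from max[OF _ this] Q(1) \<open>z \<notin> Q\<close> show False by simp
  qed
  have "card Q = CARD('n)"
    using basis_card_eq_dim[of Q UNIV] indep[OF Q] span by (simp add: dim_UNIV)
  then obtain q :: "'n \<Rightarrow> real ^ 'n" where q: "bij_betw q UNIV Q"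
    using finite_same_card_bij[of "UNIV :: 'n set" Q] Q(1) by auto
  \<comment> \<open>With the orthonormal basis as columns of \<open>m\<close>, the product
    \<open>transpose m ** S ** m\<close> is its Gram matrix with respect to
    \<open>B\<close>.\<close>
  define m :: "real ^ 'n ^ 'n" where "m = (\<chi> i j. q j $ i)"
  have col: "m *v axis j 1 = q j" for j
    by (simp add: matrix_vector_mult_basis column_def m_def vec_eq_iff)
  have "(transpose m ** S ** m) $ i $ j = (mat 1 :: real ^ 'n ^ 'n) $ i $ j" for i j
  proof -
    have "(transpose m ** S ** m) $ i $ j = axis i 1 \<bullet> ((transpose m ** (S ** m)) *v axis j 1)"
      by (simp add: matrix_vector_mult_basis column_def inner_axis' matrix_mul_assoc)
    also have "\<dots> = (m *v axis i 1) \<bullet> ((S ** m) *v axis j 1)"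
      by (simp only: inner_matrix_vector)
    also have "\<dots> = B (q i) (q j)"
      by (simp add: B_def col matrix_vector_mul_assoc[symmetric])
    also have "\<dots> = (if i = j then 1 else 0)"
      using q Q(2) by (auto simp: ON_def bij_betw_def inj_on_def)
    finally show ?thesis by (simp add: mat_def)
  qed
  then have m: "transpose m ** S ** m = mat 1" by (simp add: vec_eq_iff)
  then have "invertible m" unfolding invertible_left_inverse by blast
  with m show ?thesis by blast
qed

text \<open>Solves \<open>transpose m ** S ** m = mat 1\<close> for \<open>S\<close>. The resulting
  expression is the matrix of the inner product that \<open>Sigma_map\<close> assigns to a frame
  with matrix \<open>m\<close>, so this is surjectivity of \<open>Sigma_map\<close> on
  fibres.\<close>

lemma pos_def_eq_inverse_square:
  fixes S :: "real ^ 'n ^ 'n"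
  assumes "transpose S = S" "pos_def S"
  obtains m :: "real ^ 'n ^ 'n" where "invertible m" "S = transpose (matrix_inv m) ** matrix_inv m"
proof -
  obtain m :: "real ^ 'n ^ 'n" where m: "invertible m" "transpose m ** S ** m = mat 1"
    using pos_def_orthonormal_frame[OF assms] by blast
  let ?i = "matrix_inv m"
  have t: "transpose ?i ** transpose m = mat 1"
    by (simp add: matrix_transpose_mul[symmetric] matrix_inv_works[OF m(1)])
  have "transpose ?i ** ?i = transpose ?i ** (transpose m ** S ** m) ** ?i" by (simp add: m(2))
  also have "\<dots> = (transpose ?i ** transpose m) ** S ** (m ** ?i)" by (simp only: matrix_mul_assoc)
  also have "\<dots> = S" by (simp add: t matrix_inv_works[OF m(1)])
  finally show ?thesis using that[OF m(1)] by simp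
qed

text \<open>The quadratic form is the squared norm of \<open>N *v v\<close>. This puts the values of
  \<open>Sigma_map\<close> into \<open>Sym_plus\<close>.\<close>

lemma pos_def_gram:
  fixes N :: "real ^ 'n ^ 'n"
  assumes "invertible N"
  shows "pos_def (transpose N ** N)"
  unfolding pos_def_def
proof (intro allI impI)
  fix v :: "real ^ 'n" assume "v \<noteq> 0"
  then have "N *v v \<noteq> 0"
    using assms by (metis invertible_def matrix_vector_mul_assoc matrix_vector_mul_lid
      matrix_vector_mult_0_right)
  then show "0 < v \<bullet> ((transpose N ** N) *v v)"
    by (simp add: inner_matrix_vector[symmetric])
qed

section \<open>Symmetric matrices and their coordinates by unordered pairs\<close>

definition sym_matrix :: "real ^ ('n::finite uprod) \<Rightarrow> real ^ 'n ^ 'n"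
  where "sym_matrix s = (\<chi> i j. s $ Upair i j)"

text \<open>\<open>symmetric_entries\<close> is meaningful only for symmetric index functions, so
  the matrix is first averaged with its transpose. This gives a linear map on all matrices which
  inverts \<open>sym_matrix\<close> on the symmetric ones.\<close>

definition sym_part :: "real ^ 'n ^ 'n \<Rightarrow> real ^ ('n::finite uprod)"
  where "sym_part M = symmetric_entries (\<lambda>i j. (M $ i $ j + M $ j $ i) / 2)"

lemma linear_sym_matrix: "linear sym_matrix"
  by (rule linearI) (auto simp: sym_matrix_def vec_eq_iff)

lemma transpose_sym_matrix:
  fixes s :: "real ^ ('n::finite uprod)"
  shows "transpose (sym_matrix s) = sym_matrix s"
proof -
  have "Upair i j = Upair j i" for i j :: 'n by simp
  then show ?thesis unfolding sym_matrix_def transpose_def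
    by (simp only: vec_eq_iff vec_lambda_beta) metis
qed

lemma inj_sym_matrix: "inj sym_matrix"
proof (rule injI)
  fix s t :: "real ^ ('n::finite uprod)" assume "sym_matrix s = sym_matrix t"
  then have "s $ Upair i j = t $ Upair i j" for i j by (simp add: sym_matrix_def vec_eq_iff)
  then show "s = t" by (metis uprod_exhaust vec_eq_iff)
qed

lemma sym_matrix_sym_part: "sym_matrix (sym_part M) = (1 / 2) *\<^sub>R (M + transpose M)"
  by (simp add: sym_matrix_def sym_part_def transpose_def vec_eq_iff symmetric_entries_Upair
    add.commute)

lemma sym_matrix_sym_part_symmetric: "transpose M = M \<Longrightarrow> sym_matrix (sym_part M) = M"
  by (simp add: sym_matrix_sym_part scaleR_2[symmetric])

lemma sym_part_sym_matrix: "sym_part (sym_matrix s) = s"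
  using inj_sym_matrix sym_matrix_sym_part_symmetric[OF transpose_sym_matrix] by (metis injD)

text \<open>Both identities are checked after the injective linear map \<open>sym_matrix\<close>,
  under which \<open>sym_part\<close> is the explicit average of a matrix and its transpose.\<close>

lemma linear_sym_part: "linear sym_part"
proof (rule linearI)
  show "sym_part (M + N) = sym_part M + sym_part N" for M N :: "real ^ 'n ^ 'n"
    by (rule injD[OF inj_sym_matrix])
      (simp add: linear_add[OF linear_sym_matrix] sym_matrix_sym_part
        linear_add[OF linear_transpose] algebra_simps)
  show "sym_part (r *\<^sub>R M) = r *\<^sub>R sym_part M" for r and M :: "real ^ 'n ^ 'n"
    by (rule injD[OF inj_sym_matrix])
      (simp add: linear_scale[OF linear_sym_matrix] sym_matrix_sym_part transpose_scalar
        algebra_simps)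
qed

text \<open>By homogeneity, positivity is a condition on the unit sphere. Its failure set is the
  projection of a closed set of pairs along the compact sphere, hence closed.\<close>

lemma open_pos_def: "open {s :: real ^ ('n::finite uprod). pos_def (sym_matrix s)}"
proof -
  define T where "T = {z ::
    (real ^ 'n) \<times> (real ^ ('n uprod)). fst z \<bullet> (sym_matrix (snd z) *v fst z) \<le> 0}"
  have "closed T"
  proof -
    have "continuous_on UNIV (\<lambda>z ::
      (real ^ 'n) \<times> (real ^ ('n uprod)). fst z \<bullet> (sym_matrix (snd z) *v fst z))"
      unfolding matrix_vector_mult_def sym_matrix_def by (intro continuous_intros)
    then show ?thesis unfolding T_def by (intro closed_Collect_le continuous_on_const)
  qed
  then have "closed {s. \<exists>v. v \<in> sphere 0 1 \<and> (v, s) \<in> T}"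
    by (intro closed_compact_projection) auto
  moreover have "{s. pos_def (sym_matrix s)} = - {s. \<exists>v. v \<in> sphere 0 1 \<and> (v, s) \<in> T}"
  proof (intro set_eqI iffI)
    fix s :: "real ^ ('n uprod)"
    assume "s \<in> {s. pos_def (sym_matrix s)}"
    then have pos: "0 < v \<bullet> (sym_matrix s *v v)" if "v \<in> sphere 0 1" for v
    proof -
      have "v \<noteq> 0" using that by auto
      then show ?thesis using \<open>s \<in> _\<close> by (simp add: pos_def_def)
    qed
    then show "s \<in> - {s. \<exists>v. v \<in> sphere 0 1 \<and> (v, s) \<in> T}"
      using leD by (fastforce simp: T_def)
  next
    fix s :: "real ^ ('n uprod)"
    assume s: "s \<in> - {s. \<exists>v. v \<in> sphere 0 1 \<and> (v, s) \<in> T}"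
    have "0 < v \<bullet> (sym_matrix s *v v)" if v: "v \<noteq> 0" for v
    proof -
      let ?u = "(1 / norm v) *\<^sub>R v"
      have "?u \<in> sphere 0 1" using v by simp
      with s have "(?u, s) \<notin> T" by blast
      then have "0 < ?u \<bullet> (sym_matrix s *v ?u)"
        by (simp only: T_def mem_Collect_eq fst_conv snd_conv not_le)
      then show ?thesis using v
        by (simp add: matrix_vector_mult_scaleR zero_less_mult_iff zero_less_divide_iff)
    qed
    then show "s \<in> {s. pos_def (sym_matrix s)}" by (simp add: pos_def_def)
  qed
  ultimately show ?thesis by (simp add: open_Compl)
qed

section \<open>Charts of the frame bundle and of the bundle of inner products\<close>

lemma smooth_on_jacobian:
  fixes f :: "real ^ 'n \<Rightarrow> real ^ 'm"
  assumes "open S" "smooth_on S f"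
  shows "smooth_on S (\<lambda>y. matrix (frechet_derivative f (at y)))"
  unfolding matrix_def
  by (intro smooth_on_vec_lambda assms(1)
    smooth_on_bounded_linear[OF bounded_linear_vec_nth assms(1)]
      smooth_on_frechet_derivative assms(2))

definition frame_coord :: "('a, real ^ 'n) chart \<Rightarrow> ('a, 'n::finite) frame \<Rightarrow> real ^ 'n ^ 'n"
  where "frame_coord c p = matrix (\<lambda>e. snd p e c)"

definition frame_of ::
  "('a, real ^ 'n) chart set \<Rightarrow> ('a, real ^ 'n) chart \<Rightarrow> 'a \<Rightarrow> real ^ 'n ^ 'n \<Rightarrow> ('a, 'n::finite) frame"
  where "frame_of A c x m = (x, \<lambda>e. coord_vector A c x (m *v e))"

definition frame_transition ::
  "('a, real ^ 'n) chart \<Rightarrow> ('a, real ^ 'n) chart \<Rightarrow> real ^ 'n \<Rightarrow> real ^ 'n ^ 'n \<Rightarrow> real ^ 'n ^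
    ('n::finite)"
  where "frame_transition c d y m = matrix (frechet_derivative (transition c d) (at y)) ** m"

definition tensor_coord ::
  "('a, real ^ 'n) chart set \<Rightarrow> ('a, real ^ 'n) chart \<Rightarrow> ('a, 'n::finite) tensor \<Rightarrow> real ^ ('n uprod)"
  where "tensor_coord A c p = symmetric_entries (\<lambda>i j.
    snd p (coord_vector A c (fst p) (axis i 1)) (coord_vector A c (fst p) (axis j 1)))"

definition tensor_of ::
  "('a, real ^ 'n) chart set \<Rightarrow> ('a, real ^ 'n) chart \<Rightarrow> 'a \<Rightarrow> real ^ ('n uprod) \<Rightarrow> ('a, 'n::finite)
    tensor"
  where "tensor_of A c x s = (x, \<lambda>v w.
    if v \<in> tangent_space A x \<and> w \<in> tangent_space A x then v c \<bullet> (sym_matrix s *v w c) else 0)"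

text \<open>A covariant tensor is pulled back: \<open>P\<close> is the Jacobian of the reverse
  change from \<open>d\<close> to \<open>c\<close>, taken at the \<open>d\<close>-coordinates of the
  point, and \<open>S\<close> becomes \<open>transpose P ** S ** P\<close>. Using the reverse change
  avoids inverting a Jacobian.\<close>

definition tensor_transition ::
  "('a, real ^ 'n) chart \<Rightarrow> ('a, real ^ 'n) chart \<Rightarrow> real ^ 'n \<Rightarrow> real ^ ('n uprod) \<Rightarrow> real ^
    (('n::finite) uprod)"
  where "tensor_transition c d y s =
    (let P = matrix (frechet_derivative (transition d c) (at (transition c d y)))
     in sym_part (transpose P ** sym_matrix s ** P))"

lemma fst_frame_of [simp]: "fst (frame_of A c x m) = x"
  by (simp add: frame_of_def)

lemma fst_tensor_of [simp]: "fst (tensor_of A c x s) = x"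
  by (simp add: tensor_of_def)

context
  fixes A :: "('a, real ^ 'n::finite) chart set"
  assumes A: "smooth_atlas A"
begin

section \<open>Charts of the frame bundle\<close>

lemma frame_coord_vec:
  "p \<in> frame_bundle A \<Longrightarrow> frame_coord c p *v e = snd p e c"
proof -
  assume "p \<in> frame_bundle A"
  then have "linear (snd p)" by (auto simp: frame_bundle_def)
  then have "linear (\<lambda>e. snd p e c)"
    by (intro linearI) (simp_all add: linear_add linear_scale scaleR_fun_def)
  then show ?thesis unfolding frame_coord_def by (rule matrix_vector_mul(2)[THEN fun_cong])
qed

lemma frame_bundleD:
  assumes "p \<in> frame_bundle A"
  shows "linear (snd p)" "bij_betw (snd p) UNIV (tangent_space A (fst p))" "fst p \<in> points A"
  using assms by (auto simp: frame_bundle_def)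

lemma frame_of_in_frame_bundle:
  assumes c: "c \<in> charts_at A x" and m: "invertible m"
  shows "frame_of A c x m \<in> frame_bundle A"
proof -
  have "linear (coord_vector A c x \<circ> (*v) m)"
    by (intro linear_compose linear_coord_vector[OF A c]) simp
  moreover have "bij_betw (coord_vector A c x \<circ> (*v) m) UNIV (tangent_space A x)"
  proof (rule bij_betw_trans)
    show "bij_betw ((*v) m) UNIV UNIV" using m invertible_eq_bij by blast
    show "bij_betw (coord_vector A c x) UNIV (tangent_space A x)"
      using inj_coord_vector[OF A c] tangent_space_eq_range[OF A c] by (simp add: bij_betw_def)
  qed
  moreover have "x \<in> points A" using c by (auto simp: charts_at_def points_def)
  ultimately show ?thesis by (simp add: frame_of_def frame_bundle_def o_def)
qed

lemma frame_coord_frame_of: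
  "c \<in> charts_at A x \<Longrightarrow> frame_coord c (frame_of A c x m) = m"
  by (simp add: frame_coord_def frame_of_def coord_vector_apply[OF A])

lemma frame_of_frame_coord:
  assumes p: "p \<in> frame_bundle A" and c: "c \<in> charts_at A (fst p)"
  shows "frame_of A c (fst p) (frame_coord c p) = p"
proof -
  have "coord_vector A c (fst p) (snd p e c) = snd p e" for e
    using frame_bundleD(2)[OF p] by (intro coord_vector_component[OF A c]) (auto simp: bij_betw_def)
  then show ?thesis by (simp add: frame_of_def frame_coord_vec[OF p] prod_eq_iff)
qed

lemma invertible_frame_coord:
  assumes p: "p \<in> frame_bundle A" and c: "c \<in> charts_at A (fst p)"
  shows "invertible (frame_coord c p)"
proof -
  have "bij_betw (\<lambda>v. v c) (tangent_space A (fst p)) UNIV"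
    by (rule bij_betw_byWitness[where f' = "coord_vector A c (fst p)"])
      (auto simp: coord_vector_component[OF A c] coord_vector_apply[OF A c]
        coord_vector_in_tangent_space[OF A c])
  from bij_betw_trans[OF frame_bundleD(2)[OF p] this] have "bij (\<lambda>e. snd p e c)"
    by (simp add: o_def)
  moreover have "(*v) (frame_coord c p) = (\<lambda>e. snd p e c)" by (intro ext frame_coord_vec[OF p])
  ultimately show ?thesis by (simp add: invertible_eq_bij)
qed

lemma fibre_charts_frame:
  "fibre_charts A (frame_bundle A) {m. invertible m} frame_coord frame_transition"
proof
  show "smooth_atlas A" by (fact A)
  show "fst p \<in> points A" if "p \<in> frame_bundle A" for p :: "('a, 'n) frame"
    using frame_bundleD(3)[OF that] .
  show "open {m :: real ^ 'n ^ 'n. invertible m}" by (rule open_invertible)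
  show "bij_betw (frame_coord c) {p \<in> frame_bundle A. fst p = x} {m. invertible m}"
    if c: "c \<in> charts_at A x" for c x
  proof (rule bij_betw_byWitness[where f' = "frame_of A c x"])
    show "\<forall>p\<in>{p \<in> frame_bundle A. fst p = x}. frame_of A c x (frame_coord c p) = p"
      using frame_of_frame_coord c by blast
    show "\<forall>m\<in>{m. invertible m}. frame_coord c (frame_of A c x m) = m"
      using frame_coord_frame_of[OF c] by blast
    show "frame_coord c ` {p \<in> frame_bundle A. fst p = x} \<subseteq> {m. invertible m}"
      using invertible_frame_coord c by blast
    show "frame_of A c x ` {m. invertible m} \<subseteq> {p \<in> frame_bundle A. fst p = x}"
      using frame_of_in_frame_bundle[OF c] by auto
  qed
  show "frame_coord d p = frame_transition c d (chart_map c (fst p)) (frame_coord c p)"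
    if p: "p \<in> frame_bundle A" and c: "c \<in> charts_at A (fst p)" and d: "d \<in> charts_at A (fst p)"
      for p c d
  proof (subst matrix_eq, rule allI)
    fix e
    \<comment> \<open>For fixed \<open>e\<close> the frame gives a tangent vector, whose components
      change by the Jacobian; hence the Jacobian multiplies the frame matrix from the left.\<close>
    have "snd p e \<in> tangent_space A (fst p)" using frame_bundleD(2)[OF p]
      by (auto simp: bij_betw_def)
    then show "frame_coord d p *v e =
      frame_transition c d (chart_map c (fst p)) (frame_coord c p) *v e"
      using tangent_space_transition[OF _ c d]
        matrix_vector_mul(2)[OF linear_transition_derivative[OF A c d]]
      by (simp add: frame_transition_def matrix_vector_mul_assoc[symmetric] frame_coord_vec[OF p]
        fun_eq_iff)
  qed
  show "smooth_on (chart_map c ` (chart_dom c \<inter> chart_dom d) \<times> {m. invertible m})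
      (\<lambda>z. frame_transition c d (fst z) (snd z))" if c: "c \<in> A" and d: "d \<in> A" for c d
  proof -
    let ?S = "chart_map c ` (chart_dom c \<inter> chart_dom d)"
    have S: "open (?S \<times> {m :: real ^ 'n ^ 'n. invertible m})"
      by (intro open_Times open_overlap[OF A c d] open_invertible)
    have "smooth_on (?S \<times> {m :: real ^ 'n ^ 'n. invertible m})
        (\<lambda>z. matrix (frechet_derivative (transition c d) (at (fst z))))"
      by (rule smooth_on_compose[OF S smooth_on_fst[OF S]
            smooth_on_jacobian[OF open_overlap[OF A c d] smooth_on_transition[OF A c d]]]) auto
    then show ?thesis unfolding frame_transition_def
      by (rule smooth_on_bilinear[OF bilinear_matrix_mult S _ smooth_on_snd[OF S]])
  qed
qed

section \<open>Charts of the bundle of inner products\<close>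

lemma Sym_plusD:
  assumes "p \<in> Sym_plus A"
  shows "fst p \<in> points A" "inner_product_on (tangent_space A (fst p)) (snd p)"
    "\<And>v w. \<not> (v \<in> tangent_space A (fst p) \<and> w \<in> tangent_space A (fst p)) \<Longrightarrow> snd p v w = 0"
  using assms by (auto simp: Sym_plus_def)

text \<open>Bilinear expansion in the coordinate basis. \<open>inner_product_on\<close> provides
  linearity in the first argument; in the second it comes from symmetry.\<close>

lemma tensor_eq_matrix:
  assumes p: "p \<in> Sym_plus A" and c: "c \<in> charts_at A (fst p)"
  shows "snd p (coord_vector A c (fst p) a) (coord_vector A c (fst p) b) =
    a \<bullet> (sym_matrix (tensor_coord A c p) *v b)"
proof -
  define \<beta> where "\<beta> a b = snd p (coord_vector A c (fst p) a) (coord_vector A c (fst p) b)" for a b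
  note T = coord_vector_in_tangent_space[OF A c]
  note ip = Sym_plusD(2)[OF p, unfolded inner_product_on_def]
  have sym: "\<beta> a b = \<beta> b a" for a b
    unfolding \<beta>_def using ip[THEN conjunct1, rule_format, OF T T] .
  have lin: "linear (\<lambda>a. \<beta> a b)" for b
    unfolding \<beta>_def
    by (intro linearI)
      (simp_all add: linear_add[OF linear_coord_vector[OF A c]]
        linear_scale[OF linear_coord_vector[OF A c]] T
        ip[THEN conjunct2, THEN conjunct1, rule_format]
        ip[THEN conjunct2, THEN conjunct2, THEN conjunct1, rule_format])
  have entries: "sym_matrix (tensor_coord A c p) = (\<chi> i j. \<beta> (axis i 1) (axis j 1))"
    using sym unfolding sym_matrix_def tensor_coord_def \<beta>_def
    by (simp add: symmetric_entries_Upair)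
  have expand: "\<beta> a b = (\<Sum>i\<in>UNIV. a $ i * \<beta> (axis i 1) b)" for a b
  proof -
    have "\<beta> a b = \<beta> (\<Sum>i\<in>UNIV. a $ i *\<^sub>R axis i 1) b"
      using basis_expansion[of a] by (simp only: scalar_mult_eq_scaleR)
    then show ?thesis by (simp add: linear_sum[OF lin] linear_scale[OF lin])
  qed
  have "\<beta> a b = (\<Sum>i\<in>UNIV. a $ i * (\<Sum>j\<in>UNIV. \<beta> (axis i 1) (axis j 1) * b $ j))"
    unfolding expand[of a b]
    by (intro sum.cong refl arg_cong2[where f = "(*)"])
      (simp add: sym[of _ b] expand[of b] sym mult.commute)
  then show ?thesis
    unfolding entries \<beta>_def[symmetric] by (simp add: inner_vec_def matrix_vector_mult_def)
qed

text \<open>On tangent vectors this is the matrix formula; elsewhere both forms vanish by the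
  convention of extension by zero, so they are equal as functions.\<close>

lemma tensor_of_tensor_coord:
  assumes p: "p \<in> Sym_plus A" and c: "c \<in> charts_at A (fst p)"
  shows "tensor_of A c (fst p) (tensor_coord A c p) = p"
proof -
  have "snd p v w = snd (tensor_of A c (fst p) (tensor_coord A c p)) v w" for v w
  proof (cases "v \<in> tangent_space A (fst p) \<and> w \<in> tangent_space A (fst p)")
    case True
    then show ?thesis
      using tensor_eq_matrix[OF p c, of "v c" "w c"]
      by (simp add: tensor_of_def coord_vector_component[OF A c])
  qed (use Sym_plusD(3)[OF p] in \<open>auto simp: tensor_of_def\<close>)
  then show ?thesis by (simp add: prod_eq_iff fun_eq_iff)
qed

lemma pos_def_tensor_coord:
  assumes p: "p \<in> Sym_plus A" and c: "c \<in> charts_at A (fst p)"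
  shows "pos_def (sym_matrix (tensor_coord A c p))"
  unfolding pos_def_def
proof (intro allI impI)
  fix v :: "real ^ 'n" assume "v \<noteq> 0"
  then have "coord_vector A c (fst p) v \<noteq> 0"
    using linear_0[OF linear_coord_vector[OF A c]] inj_coord_vector[OF A c] by (metis injD)
  then show "0 < v \<bullet> (sym_matrix (tensor_coord A c p) *v v)"
    unfolding tensor_eq_matrix[OF p c, symmetric]
    using Sym_plusD(2)[OF p, unfolded inner_product_on_def, THEN conjunct2, THEN conjunct2, THEN
      conjunct2,
        rule_format, OF coord_vector_in_tangent_space[OF A c]] by blast
qed

lemma tensor_coord_tensor_of:
  assumes c: "c \<in> charts_at A x"
  shows "tensor_coord A c (tensor_of A c x s) = s"
proof -
  have "snd (tensor_of A c x s) (coord_vector A c x (axis i 1)) (coord_vector A c x (axis j 1)) =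
      sym_matrix s $ i $ j" for i j
    by (simp add: tensor_of_def coord_vector_in_tangent_space[OF A c] coord_vector_apply[OF A c]
        matrix_vector_mult_basis column_def inner_axis')
  then have "tensor_coord A c (tensor_of A c x s) = symmetric_entries (\<lambda>i j. s $ Upair i j)"
    by (simp add: tensor_coord_def sym_matrix_def)
  moreover have "sym_matrix (symmetric_entries (\<lambda>i j. s $ Upair i j)) = sym_matrix s"
  proof -
    have "s $ Upair i j = s $ Upair j i" for i j by (rule arg_cong[where f = "($) s"]) simp
    then show ?thesis by (simp add: sym_matrix_def symmetric_entries_Upair)
  qed
  ultimately show ?thesis using inj_sym_matrix by (metis injD)
qed

lemma tensor_of_in_Sym_plus:
  assumes c: "c \<in> charts_at A x" and s: "pos_def (sym_matrix s)"
  shows "tensor_of A c x s \<in> Sym_plus A"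
proof -
  note sub = subspace_tangent_space[OF A c]
  have sym: "a \<bullet> (sym_matrix s *v b) = b \<bullet> (sym_matrix s *v a)" for a b
    by (metis dot_lmul_matrix inner_commute transpose_sym_matrix vector_transpose_matrix)
  have pos: "0 < v c \<bullet> (sym_matrix s *v v c)" if "v \<in> tangent_space A x" "v \<noteq> 0" for v
  proof -
    have "v c \<noteq> 0"
      using that coord_vector_component[OF A c that(1)] linear_0[OF linear_coord_vector[OF A c]]
        by metis
    then show ?thesis using s by (simp add: pos_def_def)
  qed
  have scale: "(r *\<^sub>R v) c = r *\<^sub>R v c" for r and v :: "('a, real ^ 'n) tangent"
    by (simp add: scaleR_fun_def)
  have "x \<in> points A" using c by (auto simp: charts_at_def points_def)
  moreover have "inner_product_on (tangent_space A x) (snd (tensor_of A c x s))"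
    unfolding inner_product_on_def tensor_of_def
    by (intro conjI ballI allI impI)
      (simp_all add: pos subspace_add[OF sub] subspace_scale[OF sub] scale inner_add_left,
        rule sym)
  ultimately show ?thesis by (auto simp: Sym_plus_def tensor_of_def)
qed

lemma fibre_charts_tensor:
  "fibre_charts A (Sym_plus A) {s. pos_def (sym_matrix s)} (tensor_coord A) tensor_transition"
proof
  show "smooth_atlas A" by (fact A)
  show "fst p \<in> points A" if "p \<in> Sym_plus A" for p :: "('a, 'n) tensor"
    using Sym_plusD(1)[OF that] .
  show "open {s :: real ^ ('n uprod). pos_def (sym_matrix s)}" by (rule open_pos_def)
  show "bij_betw (tensor_coord A c) {p \<in> Sym_plus A. fst p = x} {s. pos_def (sym_matrix s)}"
    if c: "c \<in> charts_at A x" for c x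
  proof (rule bij_betw_byWitness[where f' = "tensor_of A c x"])
    show "\<forall>p\<in>{p \<in> Sym_plus A. fst p = x}. tensor_of A c x (tensor_coord A c p) = p"
      using tensor_of_tensor_coord c by blast
    show "\<forall>s\<in>{s. pos_def (sym_matrix s)}. tensor_coord A c (tensor_of A c x s) = s"
      using tensor_coord_tensor_of[OF c] by blast
    show "tensor_coord A c ` {p \<in> Sym_plus A. fst p = x} \<subseteq> {s. pos_def (sym_matrix s)}"
      using pos_def_tensor_coord c by blast
    show "tensor_of A c x ` {s. pos_def (sym_matrix s)} \<subseteq> {p \<in> Sym_plus A. fst p = x}"
      using tensor_of_in_Sym_plus[OF c] by auto
  qed
  show "tensor_coord A d p = tensor_transition c d (chart_map c (fst p)) (tensor_coord A c p)"
    if p: "p \<in> Sym_plus A" and c: "c \<in> charts_at A (fst p)" and d: "d \<in> charts_at A (fst p)"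
      for p c d
  proof -
    define S where "S = sym_matrix (tensor_coord A c p)"
    define P where "P = matrix (frechet_derivative (transition d c) (at (chart_map d (fst p))))"
    \<comment> \<open>\<open>P\<close> expresses the coordinate vectors of \<open>d\<close> through
      those of \<open>c\<close>, which turns the matrix in \<open>c\<close> into the one in
      \<open>d\<close> by congruence.\<close>
    have P: "coord_vector A d (fst p) a = coord_vector A c (fst p) (P *v a)" for a
    proof -
      have "coord_vector A d (fst p) a c = P *v a"
        unfolding P_def matrix_vector_mul(2)[OF linear_transition_derivative[OF A d c]]
        by (rule coord_vector_transition[OF A c])
      then show ?thesis
        using coord_vector_component[OF A c coord_vector_in_tangent_space[OF A d, of a]] by simp
    qed
    have tr: "transition c d (chart_map c (fst p)) = chart_map d (fst p)"
      using c by (intro transition_chart_map[OF A]) (auto simp: charts_at_def)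
    have "sym_matrix (tensor_coord A d p) = transpose P ** S ** P"
    proof -
      have "axis i 1 \<bullet> (sym_matrix (tensor_coord A d p) *v axis j 1) =
          axis i 1 \<bullet> ((transpose P ** S ** P) *v axis j 1)" for i j
        unfolding tensor_eq_matrix[OF p d, symmetric] P tensor_eq_matrix[OF p c] S_def[symmetric]
        by (simp only: matrix_vector_mul_assoc inner_matrix_vector matrix_mul_assoc)
      then show ?thesis by (simp add: matrix_vector_mult_basis column_def inner_axis' vec_eq_iff)
    qed
    then have "tensor_coord A d p = sym_part (transpose P ** S ** P)"
      by (metis sym_part_sym_matrix)
    then show ?thesis by (simp add: tensor_transition_def tr P_def S_def Let_def)
  qed
  show "smooth_on (chart_map c ` (chart_dom c \<inter> chart_dom d) \<times> {s. pos_def (sym_matrix s)})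
      (\<lambda>z. tensor_transition c d (fst z) (snd z))" if c: "c \<in> A" and d: "d \<in> A" for c d
  proof -
    let ?S = "chart_map c ` (chart_dom c \<inter> chart_dom d)"
    let ?F = "{s :: real ^ ('n uprod). pos_def (sym_matrix s)}"
    let ?P = "\<lambda>y. matrix (frechet_derivative (transition d c) (at (transition c d y)))"
    have S: "open (?S \<times> ?F)"
      by (intro open_Times open_overlap[OF A c d] open_pos_def)
    have "smooth_on ?S ?P"
    proof (rule smooth_on_compose[OF open_overlap[OF A c d] smooth_on_transition[OF A c d]
            smooth_on_jacobian[OF open_overlap[OF A d c] smooth_on_transition[OF A d c]]])
      show "transition c d ` ?S \<subseteq> chart_map d ` (chart_dom d \<inter> chart_dom c)"
        using c by (auto simp: transition_chart_map[OF A])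
    qed
    then have P: "smooth_on (?S \<times> ?F) (\<lambda>z. ?P (fst z))"
      by (rule smooth_on_compose[OF S smooth_on_fst[OF S]]) auto
    show ?thesis unfolding tensor_transition_def Let_def
      by (intro smooth_on_linear[OF linear_sym_part S] smooth_on_bilinear[OF bilinear_matrix_mult S]
          smooth_on_linear[OF linear_transpose S P] P
            smooth_on_linear[OF linear_sym_matrix S smooth_on_snd[OF S]])
  qed
qed

end

section \<open>The pushed forward horizontal bundle\<close>

lemma right_action_eq: "right_action a p = (fst p, \<lambda>e. snd p (a *v e))"
  by (cases p) (simp add: right_action_def)

lemma fst_right_action [simp]: "fst (right_action a p) = fst p"
  by (simp add: right_action_eq)

lemma snd_right_action: "snd (right_action a p) e = snd p (a *v e)"
  by (simp add: right_action_eq)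

lemma right_action_inverse:
  "invertible a \<Longrightarrow> right_action (matrix_inv a) (right_action a p) = p"
  by (simp add: prod_eq_iff fun_eq_iff snd_right_action matrix_vector_mul_assoc matrix_inv_works)

lemma right_action_frame_of: "right_action a (frame_of A c x m) = frame_of A c x (m ** a)"
  by (simp add: prod_eq_iff fun_eq_iff snd_right_action)
    (simp add: frame_of_def matrix_vector_mul_assoc)

lemma Sigma_map_eq:
  "Sigma_map A p = (fst p, \<lambda>v w. if v \<in> tangent_space A (fst p) \<and> w \<in> tangent_space A (fst p)
     then inv (snd p) v \<bullet> inv (snd p) w else 0)"
  by (cases p) (simp only: Sigma_map_def prod.case fst_conv snd_conv)

text \<open>The differential of \<open>m \<mapsto> (m m\<^sup>T)\<^sup>-\<^sup>1\<close> at \<open>m\<close> in the direction \<open>B m\<close> depends on \<open>m\<close> only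
  through \<open>S = (m m\<^sup>T)\<^sup>-\<^sup>1\<close>.\<close>

definition tensor_push ::
  "real ^ ('n uprod) \<Rightarrow> (real ^ 'n) \<times> (real ^ 'n ^ 'n) \<Rightarrow> (real ^ ('n::finite)) \<times> (real ^ ('n uprod))"
  where "tensor_push s z =
    (fst z, - sym_part (transpose (snd z) ** sym_matrix s + sym_matrix s ** snd z))"

lemma fst_tensor_push [simp]: "fst (tensor_push s z) = fst z"
  by (simp add: tensor_push_def)

lemma linear_tensor_push:
  fixes s :: "real ^ ('n::finite uprod)"
  shows "linear (tensor_push s)"
proof -
  define L :: "real ^ 'n ^ 'n \<Rightarrow> real ^ ('n uprod)"
    where "L B = - sym_part (transpose B ** sym_matrix s + sym_matrix s ** B)" for B
  have L: "linear L"
    unfolding L_def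
  proof (intro linear_compose_neg linear_compose[OF _ linear_sym_part, unfolded o_def]
    linear_compose_add)
    show "linear (\<lambda>B :: real ^ 'n ^ 'n. transpose B ** sym_matrix s)"
      by (rule linear_compose[OF linear_transpose, unfolded o_def])
        (rule bilinear_matrix_mult[unfolded bilinear_def, THEN conjunct2, THEN spec])
    show "linear (\<lambda>B :: real ^ 'n ^ 'n. sym_matrix s ** B)"
      by (rule bilinear_matrix_mult[unfolded bilinear_def, THEN conjunct1, THEN spec])
  qed
  have "tensor_push s z = (fst z, L (snd z))" for z by (simp add: tensor_push_def L_def)
  then show ?thesis by (intro linearI) (simp_all add: linear_add[OF L] linear_scale[OF L])
qed

locale frame_connection =
  fixes A :: "('a, real ^ 'n::finite) chart set"
    and H :: "(('a, 'n) frame \<times> (('a, 'n) frame, (real ^ 'n) \<times> (real ^ 'n ^ 'n)) tangent) set"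
  assumes smooth_atlas: "smooth_atlas A"
    and connection: "frame_bundle_connection A H"

sublocale frame_connection \<subseteq>
  frames: fibre_charts A "frame_bundle A" "{m. invertible m}" frame_coord frame_transition
  using smooth_atlas by (rule fibre_charts_frame)

sublocale frame_connection \<subseteq>
  tensors: fibre_charts A "Sym_plus A" "{s. pos_def (sym_matrix s)}" "tensor_coord A"
    tensor_transition
  using smooth_atlas by (rule fibre_charts_tensor)

context frame_connection
begin

lemma frame_bundle_atlas_eq: "frame_bundle_atlas A = frames.lift_atlas"
proof -
  have "frame_bundle_chart A c = frames.lift_chart c" for c
    by (auto simp: frame_bundle_chart_def frames.lift_chart_def frame_coord_def fun_eq_iff)
  then show ?thesis by (simp add: frame_bundle_atlas_def frames.lift_atlas_def)
qed

lemma Sym_plus_atlas_eq: "Sym_plus_atlas A = tensors.lift_atlas"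
proof -
  have "Sym_plus_chart A c = tensors.lift_chart c" for c
    by (auto simp: Sym_plus_chart_def tensors.lift_chart_def tensor_coord_def fun_eq_iff)
  then show ?thesis by (simp add: Sym_plus_atlas_def tensors.lift_atlas_def)
qed

lemma splitting: "smooth_splitting frames.lift_atlas frames.vertical_bundle H"
  using connection by (simp add: frame_bundle_connection_def frame_bundle_atlas_eq)

lemma smooth_subbundle_H: "smooth_subbundle frames.lift_atlas H"
  using splitting by (simp add: smooth_splitting_def)

lemma H_subset: "H \<subseteq> tangent_bundle frames.lift_atlas"
  using smooth_subbundle_H by (simp add: smooth_subbundle_def)

lemma H_invariant:
  "invertible a \<Longrightarrow> tangent_map frames.lift_atlas frames.lift_atlas (right_action a) ` H = H"
  using connection by (simp add: frame_bundle_connection_def frame_bundle_atlas_eq)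

lemma H_tangent: "(p, v) \<in> H \<Longrightarrow> p \<in> frame_bundle A \<and> v \<in> tangent_space frames.lift_atlas p"
  using H_subset by (auto simp: tangent_bundle_def frames.points_lift_atlas)

section \<open>The right action and the horizontal spaces in coordinates\<close>

lemma frame_coord_right_action:
  assumes "p \<in> frame_bundle A"
  shows "frame_coord c (right_action a p) = frame_coord c p ** a"
proof -
  have "(\<lambda>e. snd (right_action a p) e c) = (*v) (frame_coord c p ** a)"
    by (intro ext) (simp add: snd_right_action matrix_vector_mul_assoc[symmetric]
      frame_coord_vec[OF smooth_atlas assms])
  then show ?thesis by (simp add: frame_coord_def[of c "right_action a p"])
qed

lemma right_action_in_frame_bundle:
  assumes p: "p \<in> frame_bundle A" and a: "invertible a"
  shows "right_action a p \<in> frame_bundle A"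
proof -
  have "linear (snd p \<circ> (*v) a)"
    using frame_bundleD(1)[OF smooth_atlas p] by (intro linear_compose) simp_all
  moreover have "bij_betw (snd p \<circ> (*v) a) UNIV (tangent_space A (fst p))"
    using a frame_bundleD(2)[OF smooth_atlas p] invertible_eq_bij by (intro bij_betw_trans) blast+
  ultimately show ?thesis
    using frame_bundleD(3)[OF smooth_atlas p]
    by (simp add: frame_bundle_def right_action_eq o_def)
qed

text \<open>In coordinates the action is \<open>(y, m) \<mapsto> (y, m ** a)\<close>, the
  restriction of a linear map, which is its own derivative.\<close>

lemma tangent_map_right_action:
  assumes p: "p \<in> frame_bundle A" and a: "invertible a" and c: "c \<in> charts_at A (fst p)"
    and v: "v \<in> tangent_space frames.lift_atlas p"
  shows "tangent_map frames.lift_atlas frames.lift_atlas (right_action a) (p, v) =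
    (right_action a p, coord_vector frames.lift_atlas (frames.lift_chart c) (right_action a p)
      (fst (v (frames.lift_chart c)), snd (v (frames.lift_chart c)) ** a))"
proof (rule tangent_map_coords[OF frames.smooth_atlas_lift frames.smooth_atlas_lift
  frames.lift_chart_at[OF p c] _ v])
  have cA: "c \<in> A" "fst p \<in> chart_dom c" using c by (auto simp: charts_at_def)
  show "frames.lift_chart c \<in> frames.lift_atlas" using cA by (simp add: frames.lift_atlas_def)
  show "open (chart_map (frames.lift_chart c) ` chart_dom (frames.lift_chart c))"
    using cA by (intro open_chart_image[OF frames.smooth_atlas_lift])
      (simp add: frames.lift_atlas_def)
  show "chart_map (frames.lift_chart c) p \<in> chart_map (frames.lift_chart c) ` chart_dom
    (frames.lift_chart c)"
    using p cA by (simp add: frames.dom_lift_chart)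
  show "right_action a q \<in> chart_dom (frames.lift_chart c) \<and>
      chart_map (frames.lift_chart c) (right_action a q) =
      (\<lambda>z. (fst z, snd z ** a)) (chart_map (frames.lift_chart c) q)"
    if "q \<in> chart_dom (frames.lift_chart c)" for q
    using that a
    by (simp add: frames.dom_lift_chart frames.map_lift_chart right_action_in_frame_bundle
      frame_coord_right_action)
  have "linear (\<lambda>z :: (real ^ 'n) \<times> (real ^ 'n ^ 'n). (fst z, snd z ** a))"
    using bilinear_ladd[OF bilinear_matrix_mult] bilinear_lmul[OF bilinear_matrix_mult]
    by (intro linearI) auto
  then show "((\<lambda>z. (fst z, snd z ** a)) has_derivative (\<lambda>z. (fst z, snd z ** a)))
      (at (chart_map (frames.lift_chart c) p))"
    by (intro bounded_linear_imp_has_derivative) (simp add: linear_conv_bounded_linear)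
qed auto

text \<open>Invariance of \<open>H\<close> read in a chart. One inclusion is enough, since the other
  follows by using it for the inverse of \<open>a\<close>.\<close>

lemma chart_fibre_right_action_subset:
  assumes p: "p \<in> frame_bundle A" and a: "invertible a" and c: "c \<in> charts_at A (fst p)"
    and z: "z \<in> chart_fibre H (frames.lift_chart c) p"
  shows "(fst z, snd z ** a) \<in> chart_fibre H (frames.lift_chart c) (right_action a p)"
proof -
  let ?k = "frames.lift_chart c"
  obtain v where v: "(p, v) \<in> H" "z = v ?k" using z by (auto simp: chart_fibre_def)
  let ?w = "coord_vector frames.lift_atlas ?k (right_action a p) (fst z, snd z ** a)"
  have "tangent_map frames.lift_atlas frames.lift_atlas (right_action a) (p, v) =
    (right_action a p, ?w)"
    using tangent_map_right_action[OF p a c] H_tangent[OF v(1)] v(2) by blast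
  then have "(right_action a p, ?w) \<in> H"
    using H_invariant[OF a] v(1) by (metis imageI)
  from chart_fibreI[OF this, of ?k] show ?thesis
    using frames.lift_chart_at[OF right_action_in_frame_bundle[OF p a], of c] c
    by (simp add: coord_vector_apply[OF frames.smooth_atlas_lift])
qed

text \<open>The horizontal space at the coordinate frame of \<open>c\<close>. It is the graph of
  \<open>v \<mapsto> -\<Gamma>(v)\<close>, where \<open>\<Gamma>(v)\<close> is the matrix of
  Christoffel symbols of the connection in the direction \<open>v\<close>.\<close>

definition base_fibre :: "('a, real ^ 'n) chart \<Rightarrow> 'a \<Rightarrow> ((real ^ 'n) \<times> (real ^ 'n ^ 'n)) set"
  where "base_fibre c x = chart_fibre H (frames.lift_chart c) (frame_of A c x (mat 1))"

text \<open>A frame arises from the coordinate frame at its base point by the right action of its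
  own matrix, and the inverse matrix leads back.\<close>

lemma chart_fibre_frame:
  assumes p: "p \<in> frame_bundle A" and c: "c \<in> charts_at A (fst p)"
  shows "chart_fibre H (frames.lift_chart c) p =
    (\<lambda>z. (fst z, snd z ** frame_coord c p)) ` base_fibre c (fst p)"
proof
  let ?k = "frames.lift_chart c" and ?m = "frame_coord c p" and ?q = "frame_of A c (fst p) (mat 1)"
  have m: "invertible ?m" by (rule invertible_frame_coord[OF smooth_atlas p c])
  have q: "?q \<in> frame_bundle A"
    by (rule frame_of_in_frame_bundle[OF smooth_atlas c invertible_mat_1])
  have pq: "right_action ?m ?q = p"
    by (simp add: right_action_frame_of frame_of_frame_coord[OF smooth_atlas p c])
  show "(\<lambda>z. (fst z, snd z ** ?m)) ` base_fibre c (fst p) \<subseteq> chart_fibre H ?k p"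
    using chart_fibre_right_action_subset[OF q m, of c] c pq by (auto simp: base_fibre_def)
  show "chart_fibre H ?k p \<subseteq> (\<lambda>z. (fst z, snd z ** ?m)) ` base_fibre c (fst p)"
  proof
    fix z assume "z \<in> chart_fibre H ?k p"
    from chart_fibre_right_action_subset[OF p invertible_matrix_inv[OF m] c this]
    have "(fst z, snd z ** matrix_inv ?m) \<in> base_fibre c (fst p)"
      using right_action_inverse[OF m, of ?q] pq by (simp add: base_fibre_def)
    moreover have "z = (fst z, (snd z ** matrix_inv ?m) ** ?m)"
      by (simp add: matrix_mul_assoc[symmetric] matrix_inv_works[OF m])
    ultimately show "z \<in> (\<lambda>z. (fst z, snd z ** ?m)) ` base_fibre c (fst p)"
      by (intro image_eqI[of z _ "(fst z, snd z ** matrix_inv ?m)"]) simp_all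
  qed
qed

lemma bij_base_fibre:
  assumes c: "c \<in> charts_at A x"
  shows "bij_betw fst (base_fibre c x) UNIV"
  unfolding base_fibre_def
  using frames.splitting_fst_bij[OF splitting
    frame_of_in_frame_bundle[OF smooth_atlas c invertible_mat_1]] c
  by simp

section \<open>The map \<open>Sigma_map\<close> and its differential in coordinates\<close>

lemma Sigma_map_coord:
  assumes p: "p \<in> frame_bundle A" and c: "c \<in> charts_at A (fst p)"
  shows "Sigma_map A p = tensor_of A c (fst p)
    (sym_part (transpose (matrix_inv (frame_coord c p)) ** matrix_inv (frame_coord c p)))"
proof -
  let ?N = "matrix_inv (frame_coord c p)"
  note m = invertible_frame_coord[OF smooth_atlas p c]
  \<comment> \<open>Inverting the frame is multiplication of components by the inverse matrix
    \<open>?N\<close>, so the inner product of the inverses has the Gram matrix of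
    \<open>?N\<close>.\<close>
  have inv: "inv (snd p) v = ?N *v v c" if v: "v \<in> tangent_space A (fst p)" for v
  proof -
    have "snd p (?N *v v c) \<in> tangent_space A (fst p)"
      using frame_bundleD(2)[OF smooth_atlas p] by (auto simp: bij_betw_def)
    moreover have "snd p (?N *v v c) c = v c"
      by (simp add: frame_coord_vec[OF smooth_atlas p, symmetric] matrix_vector_mul_assoc
        matrix_inv_works[OF m])
    ultimately have "snd p (?N *v v c) = v"
      using tangent_vector_eqI[OF smooth_atlas c _ v] by blast
    moreover have "inj (snd p)" using frame_bundleD(2)[OF smooth_atlas p]
      by (simp add: bij_betw_def)
    ultimately show ?thesis by (metis inv_f_f)
  qed
  have "sym_matrix (sym_part (transpose ?N ** ?N)) = transpose ?N ** ?N"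
    by (rule sym_matrix_sym_part_symmetric) (simp add: matrix_transpose_mul)
  then have "v c \<bullet> (sym_matrix (sym_part (transpose ?N ** ?N)) *v w c) =
    inv (snd p) v \<bullet> inv (snd p) w"
    if "v \<in> tangent_space A (fst p)" "w \<in> tangent_space A (fst p)" for v w
    using that by (simp add: inv inner_matrix_vector)
  then show ?thesis
    by (simp add: Sigma_map_eq tensor_of_def fun_eq_iff)
qed

lemma tensor_coord_Sigma_map:
  assumes p: "p \<in> frame_bundle A" and c: "c \<in> charts_at A (fst p)"
  shows "sym_matrix (tensor_coord A c (Sigma_map A p)) =
      transpose (matrix_inv (frame_coord c p)) ** matrix_inv (frame_coord c p)"
    and "tensor_coord A c (Sigma_map A p) =
      sym_part (transpose (matrix_inv (frame_coord c p)) ** matrix_inv (frame_coord c p))"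
    and "Sigma_map A p \<in> Sym_plus A" and "fst (Sigma_map A p) = fst p"
proof -
  let ?N = "matrix_inv (frame_coord c p)"
  have sym: "sym_matrix (sym_part (transpose ?N ** ?N)) = transpose ?N ** ?N"
    by (rule sym_matrix_sym_part_symmetric) (simp add: matrix_transpose_mul)
  note eq = Sigma_map_coord[OF p c]
  show *: "tensor_coord A c (Sigma_map A p) = sym_part (transpose ?N ** ?N)"
    unfolding eq by (rule tensor_coord_tensor_of[OF smooth_atlas c])
  then show "sym_matrix (tensor_coord A c (Sigma_map A p)) = transpose ?N ** ?N" using sym by simp
  show "Sigma_map A p \<in> Sym_plus A"
    unfolding eq using pos_def_gram[OF
      invertible_matrix_inv[OF invertible_frame_coord[OF smooth_atlas p c]]] sym
    by (intro tensor_of_in_Sym_plus[OF smooth_atlas c]) simp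
  show "fst (Sigma_map A p) = fst p" unfolding eq by simp
qed

text \<open>Every inner product has an orthonormal frame. It supplies the frame from which vectors
  over \<open>\<sigma>\<close> are pushed forward.\<close>

lemma Sigma_map_frame_of:
  assumes \<sigma>: "\<sigma> \<in> Sym_plus A" and c: "c \<in> charts_at A (fst \<sigma>)"
  obtains p where "p \<in> frame_bundle A" "fst p = fst \<sigma>" "Sigma_map A p = \<sigma>"
proof -
  let ?S = "sym_matrix (tensor_coord A c \<sigma>)"
  obtain m :: "real ^ 'n ^ 'n"
    where m: "invertible m" "?S = transpose (matrix_inv m) ** matrix_inv m"
    using pos_def_eq_inverse_square[OF transpose_sym_matrix
      pos_def_tensor_coord[OF smooth_atlas \<sigma> c]] .
  let ?p = "frame_of A c (fst \<sigma>) m"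
  have p: "?p \<in> frame_bundle A" by (rule frame_of_in_frame_bundle[OF smooth_atlas c m(1)])
  have "Sigma_map A ?p = tensor_of A c (fst \<sigma>) (sym_part ?S)"
    using Sigma_map_coord[OF p, of c] c m(2) by (simp add: frame_coord_frame_of[OF smooth_atlas])
  then have "Sigma_map A ?p = \<sigma>"
    by (simp add: sym_part_sym_matrix tensor_of_tensor_coord[OF smooth_atlas \<sigma> c])
  with p show ?thesis using that by simp
qed

text \<open>Product rule for \<open>transpose N ** N\<close>, where \<open>N\<close> as a function
  of the frame matrix has derivative \<open>- (N ** W ** N)\<close> in the direction
  \<open>W\<close>.\<close>

lemma Sigma_has_derivative:
  fixes m :: "real ^ 'n ^ 'n"
  assumes m: "invertible m"
  defines "N \<equiv> matrix_inv m"
  shows "((\<lambda>z. (fst z, sym_part (transpose (matrix_inv (snd z)) ** matrix_inv (snd z))))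
    has_derivative
    (\<lambda>z. (fst z, - sym_part (transpose (N ** snd z ** N) ** N + transpose N ** (N ** snd z ** N)))))
    (at (y :: real ^ 'n, m))"
proof -
  have snd: "(snd has_derivative snd) (at (y, m))"
    by (rule has_derivative_snd[OF has_derivative_ident])
  have inv: "((\<lambda>z. matrix_inv (snd z)) has_derivative (\<lambda>z. - (N ** snd z ** N))) (at (y, m))"
    using diff_chain_at[OF snd, of matrix_inv] has_derivative_matrix_inv[OF m]
      by (simp add: o_def N_def)
  have tr: "((\<lambda>z. transpose (matrix_inv (snd z))) has_derivative
    (\<lambda>z. transpose (- (N ** snd z ** N)))) (at (y, m))"
    using linear_transpose[unfolded linear_conv_bounded_linear] inv
      by (rule bounded_linear.has_derivative)
  have prod: "((\<lambda>z. transpose (matrix_inv (snd z)) ** matrix_inv (snd z)) has_derivative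
      (\<lambda>z. transpose N ** (- (N ** snd z ** N)) + transpose (- (N ** snd z ** N)) ** N))
        (at (y, m))"
    using bounded_bilinear.FDERIV[OF bilinear_matrix_mult[unfolded bilinear_conv_bounded_bilinear]
      tr inv]
    by (simp add: N_def)
  have "((\<lambda>z. sym_part (transpose (matrix_inv (snd z)) ** matrix_inv (snd z))) has_derivative
      (\<lambda>z. sym_part (transpose N ** (- (N ** snd z ** N)) + transpose (- (N ** snd z ** N)) ** N)))
        (at (y, m))"
    using linear_sym_part[unfolded linear_conv_bounded_linear] prod
      by (rule bounded_linear.has_derivative)
  moreover have "sym_part (transpose N ** (- X) + transpose (- X) ** N) =
      - sym_part (transpose X ** N + transpose N ** X)" for X :: "real ^ 'n ^ 'n"
    by (simp add: linear_neg[OF linear_transpose] bilinear_lneg[OF bilinear_matrix_mult]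
        bilinear_rneg[OF bilinear_matrix_mult] linear_neg[OF linear_sym_part, symmetric]
          add.commute)
  ultimately show ?thesis
    by (intro has_derivative_Pair has_derivative_fst[OF has_derivative_ident]) simp
qed

lemma tangent_map_Sigma:
  assumes p: "p \<in> frame_bundle A" and c: "c \<in> charts_at A (fst p)"
    and v: "v \<in> tangent_space frames.lift_atlas p"
    and z: "v (frames.lift_chart c) = (fst z, snd z ** frame_coord c p)"
  shows "tangent_map frames.lift_atlas tensors.lift_atlas (Sigma_map A) (p, v) =
    (Sigma_map A p, coord_vector tensors.lift_atlas (tensors.lift_chart c) (Sigma_map A p)
      (tensor_push (tensor_coord A c (Sigma_map A p)) z))"
proof -
  let ?k = "frames.lift_chart c"
  let ?m = "frame_coord c p" and ?N = "matrix_inv (frame_coord c p)"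
  note m = invertible_frame_coord[OF smooth_atlas p c]
  have cA: "c \<in> A" "fst p \<in> chart_dom c" using c by (auto simp: charts_at_def)
  have "tangent_map frames.lift_atlas tensors.lift_atlas (Sigma_map A) (p, v) =
    (Sigma_map A p, coord_vector tensors.lift_atlas (tensors.lift_chart c) (Sigma_map A p)
      ((\<lambda>z. (fst z, - sym_part
        (transpose (?N ** snd z ** ?N) ** ?N + transpose ?N ** (?N ** snd z ** ?N)))) (v ?k)))"
  proof (rule tangent_map_coords[OF frames.smooth_atlas_lift tensors.smooth_atlas_lift
    frames.lift_chart_at[OF p c] _ v])
    show "tensors.lift_chart c \<in> tensors.lift_atlas" using cA by (simp add: tensors.lift_atlas_def)
    show "open (chart_map ?k ` chart_dom ?k)"
      using cA by (intro open_chart_image[OF frames.smooth_atlas_lift])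
        (simp add: frames.lift_atlas_def)
    show "chart_map ?k p \<in> chart_map ?k ` chart_dom ?k"
      using p cA by (simp add: frames.dom_lift_chart)
    show "Sigma_map A q \<in> chart_dom (tensors.lift_chart c) \<and>
        chart_map (tensors.lift_chart c) (Sigma_map A q) =
        (\<lambda>z. (fst z, sym_part (transpose (matrix_inv (snd z)) ** matrix_inv (snd z))))
          (chart_map ?k q)"
      if "q \<in> chart_dom ?k" for q
    proof -
      have q: "q \<in> frame_bundle A" "c \<in> charts_at A (fst q)"
        using that cA by (auto simp: frames.dom_lift_chart charts_at_def)
      show ?thesis
        using that tensor_coord_Sigma_map(2-4)[OF q]
        by (simp add: frames.dom_lift_chart tensors.dom_lift_chart frames.map_lift_chart
          tensors.map_lift_chart)
    qed
  qed (auto simp: frames.map_lift_chart intro: Sigma_has_derivative[OF m])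
  note tm = this
  \<comment> \<open>The frame matrix cancels here. What remains of it is
    \<open>transpose ?N ** ?N\<close>, the matrix of the inner product, which is how the dependence
    on the frame disappears.\<close>
  have "?N ** (snd z ** ?m) ** ?N = ?N ** snd z"
    by (simp add: matrix_mul_assoc[symmetric] matrix_inv_works[OF m])
  note tm = tm[unfolded z fst_conv snd_conv this]
  show ?thesis
    unfolding tm tensor_push_def tensor_coord_Sigma_map(1)[OF p c]
    by (simp only: matrix_transpose_mul matrix_mul_assoc)
qed

section \<open>The image bundle, its fibres and its local frames\<close>

definition HS where "HS = tangent_map frames.lift_atlas tensors.lift_atlas (Sigma_map A) ` H"

lemma HS_memberE:
  assumes "(\<sigma>, h) \<in> HS"
  obtains p v where "(p, v) \<in> H" "p \<in> frame_bundle A" "v \<in> tangent_space frames.lift_atlas p"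
    "\<sigma> = Sigma_map A p"
      "(\<sigma>, h) = tangent_map frames.lift_atlas tensors.lift_atlas (Sigma_map A) (p, v)"
proof -
  obtain p v where pv: "(p, v) \<in> H"
    "(\<sigma>, h) = tangent_map frames.lift_atlas tensors.lift_atlas (Sigma_map A) (p, v)"
    using assms unfolding HS_def by auto
  then show ?thesis using that[OF pv(1) _ _ _ pv(2)] H_tangent[OF pv(1)]
    by (simp add: tangent_map_def)
qed

lemma HS_element:
  assumes pv: "(p, v) \<in> H" and c: "c \<in> charts_at A (fst p)"
  obtains z where "z \<in> base_fibre c (fst p)"
    "v (frames.lift_chart c) = (fst z, snd z ** frame_coord c p)"
  using chart_fibreI[OF pv, of "frames.lift_chart c"] H_tangent[OF pv] chart_fibre_frame[of p c] c
    that
  by auto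

lemma HS_subset: "HS \<subseteq> tangent_bundle tensors.lift_atlas"
proof
  fix x assume "x \<in> HS"
  obtain \<sigma> h where x: "x = (\<sigma>, h)" by (cases x)
  with \<open>x \<in> HS\<close> obtain p v where pv: "(p, v) \<in> H" "p \<in> frame_bundle A"
    "v \<in> tangent_space frames.lift_atlas p" "\<sigma> = Sigma_map A p"
    "(\<sigma>, h) = tangent_map frames.lift_atlas tensors.lift_atlas (Sigma_map A) (p, v)"
    using HS_memberE by blast
  obtain c where c: "c \<in> charts_at A (fst p)" using frames.chart_exists[OF pv(2)] .
  obtain z where z: "z \<in> base_fibre c (fst p)"
    "v (frames.lift_chart c) = (fst z, snd z ** frame_coord c p)"
    using HS_element[OF pv(1) c] .
  have S: "\<sigma> \<in> Sym_plus A" "c \<in> charts_at A (fst \<sigma>)"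
    using tensor_coord_Sigma_map(3,4)[OF pv(2) c] pv(4) c by auto
  show "x \<in> tangent_bundle tensors.lift_atlas"
    using pv(5) tangent_map_Sigma[OF pv(2) c pv(3) z(2)] S x
      coord_vector_in_tangent_space[OF tensors.smooth_atlas_lift tensors.lift_chart_at[OF S]]
    by (simp add: tangent_bundle_def tensors.points_lift_atlas)
qed

text \<open>A vector of \<open>HS\<close> comes from some frame over \<open>\<sigma>\<close>, and
  \<open>tangent_map_Sigma\<close> gives its component without reference to that frame. For the
  reverse inclusion one frame over \<open>\<sigma>\<close> is enough.\<close>

lemma chart_fibre_HS:
  assumes \<sigma>: "\<sigma> \<in> Sym_plus A" and c: "c \<in> charts_at A (fst \<sigma>)"
  shows "chart_fibre HS (tensors.lift_chart c) \<sigma> =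
    tensor_push (tensor_coord A c \<sigma>) ` base_fibre c (fst \<sigma>)"
proof
  let ?l = "tensors.lift_chart c"
  note l = coord_vector_apply[OF tensors.smooth_atlas_lift tensors.lift_chart_at[OF \<sigma> c]]
  show "chart_fibre HS ?l \<sigma> \<subseteq> tensor_push (tensor_coord A c \<sigma>) ` base_fibre c (fst \<sigma>)"
  proof
    fix w assume "w \<in> chart_fibre HS ?l \<sigma>"
    then obtain h where h: "(\<sigma>, h) \<in> HS" "w = h ?l" by (auto simp: chart_fibre_def)
    obtain p v where pv: "(p, v) \<in> H" "p \<in> frame_bundle A"
      "v \<in> tangent_space frames.lift_atlas p" "\<sigma> = Sigma_map A p"
      "(\<sigma>, h) = tangent_map frames.lift_atlas tensors.lift_atlas (Sigma_map A) (p, v)"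
      using HS_memberE[OF h(1)] .
    \<comment> \<open>\<open>c\<close> is a chart around the base point of \<open>\<sigma>\<close>.
      The auxiliary chart \<open>d\<close> serves to show that \<open>p\<close> has the same base
      point; afterwards \<open>c\<close> can be used for \<open>p\<close>.\<close>
    obtain d where d: "d \<in> charts_at A (fst p)" using frames.chart_exists[OF pv(2)] .
    have fst: "fst \<sigma> = fst p" using tensor_coord_Sigma_map(4)[OF pv(2) d] pv(4) by simp
    then have c': "c \<in> charts_at A (fst p)" using c by simp
    obtain z where z: "z \<in> base_fibre c (fst p)"
      "v (frames.lift_chart c) = (fst z, snd z ** frame_coord c p)"
      using HS_element[OF pv(1) c'] .
    have "w = tensor_push (tensor_coord A c \<sigma>) z"
      using pv(4,5) tangent_map_Sigma[OF pv(2) c' pv(3) z(2)] l h(2) by simp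
    then show "w \<in> tensor_push (tensor_coord A c \<sigma>) ` base_fibre c (fst \<sigma>)" using z(1) fst by simp
  qed
  show "tensor_push (tensor_coord A c \<sigma>) ` base_fibre c (fst \<sigma>) \<subseteq> chart_fibre HS ?l \<sigma>"
  proof
    fix w assume "w \<in> tensor_push (tensor_coord A c \<sigma>) ` base_fibre c (fst \<sigma>)"
    then obtain z where z: "z \<in> base_fibre c (fst \<sigma>)" "w = tensor_push (tensor_coord A c \<sigma>) z"
      by blast
    obtain p where p: "p \<in> frame_bundle A" "fst p = fst \<sigma>" "Sigma_map A p = \<sigma>"
      using Sigma_map_frame_of[OF \<sigma> c] .
    have c': "c \<in> charts_at A (fst p)" using c p by simp
    have "(fst z, snd z ** frame_coord c p) \<in> chart_fibre H (frames.lift_chart c) p"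
      unfolding chart_fibre_frame[OF p(1) c'] using z p by simp
    then obtain v where v: "(p, v) \<in> H"
      "v (frames.lift_chart c) = (fst z, snd z ** frame_coord c p)"
      by (auto simp: chart_fibre_def)
    have "tangent_map frames.lift_atlas tensors.lift_atlas (Sigma_map A) (p, v) =
        (\<sigma>, coord_vector tensors.lift_atlas ?l \<sigma> w)"
      using tangent_map_Sigma[OF p(1) c' conjunct2[OF H_tangent[OF v(1)]] v(2)] p(3) z(2) by simp
    then have "(\<sigma>, coord_vector tensors.lift_atlas ?l \<sigma> w) \<in> HS"
      unfolding HS_def using v(1) by (metis imageI)
    from chart_fibreI[OF this, of ?l] show "w \<in> chart_fibre HS ?l \<sigma>" by (simp add: l)
  qed
qed

text \<open>\<open>tensor_push\<close> preserves first components, so bijectivity of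
  \<open>fst\<close> passes from the horizontal space of the coordinate frame to its image.\<close>

lemma bij_chart_fibre_HS:
  assumes \<sigma>: "\<sigma> \<in> Sym_plus A" and c: "c \<in> charts_at A (fst \<sigma>)"
  shows "bij_betw fst (chart_fibre HS (tensors.lift_chart c) \<sigma>) UNIV"
  using bij_base_fibre[OF c] unfolding chart_fibre_HS[OF \<sigma> c]
  by (auto simp: bij_betw_def inj_on_def image_image)

lemma smooth_subbundle_HS: "smooth_subbundle tensors.lift_atlas HS"
proof (rule tensors.smooth_subbundle_lift[OF HS_subset])
  fix x c assume c: "c \<in> charts_at A x"
  then have cA: "c \<in> A" "x \<in> chart_dom c" by (auto simp: charts_at_def)
  let ?k = "frames.lift_chart c"
  let ?F = "{s :: real ^ ('n uprod). pos_def (sym_matrix s)}"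
  let ?q = "\<lambda>x. frame_of A c x (mat 1)"
  have q: "?q x \<in> frame_bundle A" "?q x \<in> chart_dom ?k"
    "chart_map ?k (?q x) = (chart_map c x, mat 1)"
    "chart_inv ?k (chart_map c x, mat 1) = ?q x" if "x \<in> chart_dom c" for x
  proof -
    have c: "c \<in> charts_at A x" using that cA by (simp add: charts_at_def)
    show 1: "?q x \<in> frame_bundle A"
      by (rule frame_of_in_frame_bundle[OF smooth_atlas c invertible_mat_1])
    then show 2: "?q x \<in> chart_dom ?k" using that by (simp add: frames.dom_lift_chart)
    show 3: "chart_map ?k (?q x) = (chart_map c x, mat 1)"
      by (simp add: frames.map_lift_chart frame_coord_frame_of[OF smooth_atlas c])
    show "chart_inv ?k (chart_map c x, mat 1) = ?q x"
      using frames.chart_inv_lift_chart[OF cA(1) 2] 3 by simp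
  qed
  have kA: "?k \<in> frames.lift_atlas" using cA by (simp add: frames.lift_atlas_def)
  have "?q x \<in> points frames.lift_atlas" using q(1)[OF cA(2)] frames.points_lift_atlas by simp
  then obtain W and k :: nat and X where W: "openin (atlas_topology frames.lift_atlas) W" "?q x \<in> W"
    and X: "\<forall>i<k. smooth_vector_field_on frames.lift_atlas W (X i)"
    and fr: "\<forall>p\<in>W. inj_on (\<lambda>i. X i p) {..<k} \<and> independent ((\<lambda>i. X i p) ` {..<k}) \<and>
       span ((\<lambda>i. X i p) ` {..<k}) = H `` {p}"
    by (rule smooth_subbundleE[OF smooth_subbundle_H])
  let ?O = "chart_map ?k ` (W \<inter> chart_dom ?k)"
  have open_O: "open ?O" using W(1) kA
    by (simp add: openin_atlas_topology[OF frames.smooth_atlas_lift])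
  \<comment> \<open>The base coordinates whose coordinate frame lies in \<open>W\<close>, where the
    local frame of \<open>H\<close> is available; open as a preimage under the section
    \<open>y \<mapsto> (y, mat 1)\<close>.\<close>
  define V where "V = chart_map c ` chart_dom c \<inter> (\<lambda>y. (y, mat 1)) -` ?O"
  have open_V: "open V" unfolding V_def
    by (intro open_Int open_chart_image[OF smooth_atlas cA(1)] open_vimage[OF open_O]
      continuous_intros)
  \<comment> \<open>Components of the local frame of \<open>H\<close> along that section. They
    depend on the base point alone; the inner product enters \<open>Z\<close> only through
    \<open>tensor_push\<close>, which is built from bilinear operations.\<close>
  define \<xi> where "\<xi> i y = X i (chart_inv ?k (y, mat 1)) ?k" for i y
  define Z where "Z i z = tensor_push (snd z) (\<xi> i (fst z))" for i
    and z :: "(real ^ 'n) \<times> (real ^ ('n uprod))"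
  have "smooth_on (V \<times> ?F) (Z i)" if i: "i < k" for i
  proof -
    have open_VF: "open (V \<times> ?F)" by (intro open_Times open_V open_pos_def)
    have "smooth_on ?O (\<lambda>y. X i (chart_inv ?k y) ?k)"
      using X i kA by (simp add: smooth_vector_field_on_def)
    from smooth_on_compose[OF open_V smooth_on_Pair[OF open_V smooth_on_ident smooth_on_const] this]
    have "smooth_on V (\<xi> i)" using open_V unfolding \<xi>_def V_def by blast
    from smooth_on_compose[OF open_VF smooth_on_fst[OF open_VF] this]
    have xi: "smooth_on (V \<times> ?F) (\<lambda>z. \<xi> i (fst z))" by auto
    note fst_xi = smooth_on_bounded_linear[OF bounded_linear_fst open_VF xi]
      and snd_xi = smooth_on_bounded_linear[OF bounded_linear_snd open_VF xi]
      and sym = smooth_on_linear[OF linear_sym_matrix open_VF smooth_on_snd[OF open_VF]]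
    show ?thesis
      unfolding Z_def tensor_push_def
      by (intro smooth_on_Pair[OF open_VF] fst_xi
          smooth_on_bounded_linear[OF bounded_linear_minus[OF bounded_linear_ident] open_VF]
          smooth_on_linear[OF linear_sym_part open_VF] smooth_on_add[OF open_VF]
          smooth_on_bilinear[OF bilinear_matrix_mult open_VF] sym snd_xi
          smooth_on_linear[OF linear_transpose open_VF])
  qed
  moreover have "inj_on (\<lambda>i. Z i (chart_map (tensors.lift_chart c) \<sigma>)) {..<k} \<and>
         independent ((\<lambda>i. Z i (chart_map (tensors.lift_chart c) \<sigma>)) ` {..<k}) \<and>
         span ((\<lambda>i. Z i (chart_map (tensors.lift_chart c) \<sigma>)) ` {..<k}) = chart_fibre HS
           (tensors.lift_chart c) \<sigma>"
    if \<sigma>: "\<sigma> \<in> Sym_plus A" and dom: "fst \<sigma> \<in> chart_dom c" and V: "chart_map c (fst \<sigma>) \<in> V" for \<sigma>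
  proof -
    let ?x = "fst \<sigma>" and ?s = "tensor_coord A c \<sigma>"
    have c': "c \<in> charts_at A ?x" using dom cA by (simp add: charts_at_def)
    \<comment> \<open>The linear map carrying the horizontal space at the coordinate frame onto the
      chart fibre of \<open>HS\<close> at \<open>\<sigma>\<close>; it transports the frame
      property.\<close>
    define \<Lambda> where "\<Lambda> v = tensor_push ?s (v ?k)"
      for v :: "(('a, 'n) frame, (real ^ 'n) \<times> (real ^ 'n ^ 'n)) tangent"
    have Z: "Z i (chart_map (tensors.lift_chart c) \<sigma>) = \<Lambda> (X i (?q ?x))" for i
      by (simp add: Z_def \<Lambda>_def \<xi>_def tensors.map_lift_chart q(4)[OF dom])
    have "?q ?x \<in> W"
    proof -
      \<comment> \<open>Membership in \<open>V\<close> provides a point of \<open>W\<close> with the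
        coordinates of the coordinate frame, and injectivity of the chart identifies the
        two.\<close>
      obtain r where r: "r \<in> W" "r \<in> chart_dom ?k" "chart_map ?k r = (chart_map c ?x, mat 1)"
        using V by (auto simp: V_def)
      then have "r = ?q ?x" using frames.chart_inv_lift_chart[OF cA(1) r(2)] q(4)[OF dom] by simp
      with r show ?thesis by simp
    qed
    from fr[THEN bspec, OF this]
    have inj: "inj_on (\<lambda>i. X i (?q ?x)) {..<k}" and ind: "independent ((\<lambda>i. X i (?q ?x)) ` {..<k})"
      and span: "span ((\<lambda>i. X i (?q ?x)) ` {..<k}) = H `` {?q ?x}" by auto
    have lin: "linear \<Lambda>"
      using linear_add[OF linear_tensor_push] linear_scale[OF linear_tensor_push]
      by (intro linearI) (simp_all add: \<Lambda>_def scaleR_fun_def)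
    have im: "\<Lambda> ` (H `` {?q ?x}) = chart_fibre HS (tensors.lift_chart c) \<sigma>"
      unfolding chart_fibre_HS[OF \<sigma> c']
        by (simp add: base_fibre_def chart_fibre_def[of H] \<Lambda>_def image_image)
    have inj_\<Lambda>: "inj_on \<Lambda> (H `` {?q ?x})"
    proof (rule inj_onI)
      fix v w assume v: "v \<in> H `` {?q ?x}" and w: "w \<in> H `` {?q ?x}" and eq: "\<Lambda> v = \<Lambda> w"
      \<comment> \<open>\<open>\<Lambda>\<close> keeps first components, and a horizontal vector is
        determined by its first component.\<close>
      have "fst (v ?k) = fst (w ?k)" using eq unfolding \<Lambda>_def by (metis fst_tensor_push)
      moreover have "v ?k \<in> base_fibre c ?x" "w ?k \<in> base_fibre c ?x"
        using v w unfolding base_fibre_def chart_fibre_def by blast+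
      ultimately have "v ?k = w ?k" using bij_base_fibre[OF c']
        by (auto simp: bij_betw_def inj_on_def)
      then show "v = w"
        using tangent_vector_eqI[OF frames.smooth_atlas_lift
          frames.lift_chart_at[OF q(1)[OF dom], of c], of v w]
          H_tangent[of "?q ?x"] v w c' by auto
    qed
    have img: "(\<lambda>i. \<Lambda> (X i (?q ?x))) ` {..<k} = \<Lambda> ` (\<lambda>i. X i (?q ?x)) ` {..<k}"
      by (simp only: image_image)
    have "(\<lambda>i. X i (?q ?x)) ` {..<k} \<subseteq> H `` {?q ?x}"
      unfolding span[symmetric] by (rule span_superset)
    from comp_inj_on[OF inj inj_on_subset[OF inj_\<Lambda> this]] have "inj_on (\<lambda>i. \<Lambda> (X i (?q ?x))) {..<k}"
      by (simp add: o_def)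
    moreover have "independent (\<Lambda> ` (\<lambda>i. X i (?q ?x)) ` {..<k})"
      using linear_independent_injective_image[OF lin ind] inj_\<Lambda> span by simp
    moreover have "span (\<Lambda> ` (\<lambda>i. X i (?q ?x)) ` {..<k}) = chart_fibre HS (tensors.lift_chart c) \<sigma>"
      using linear_span_image[OF lin] span im by simp
    ultimately show ?thesis unfolding Z img by blast
  qed
  moreover have "chart_map c x \<in> V"
    using W(2) q(2,3)[OF cA(2)] cA(2) unfolding V_def by (auto intro!: image_eqI[of _ _ "?q x"])
  moreover have "V \<subseteq> chart_map c ` chart_dom c" by (auto simp: V_def)
  ultimately show "\<exists>V (k::nat) Z.
      open V \<and> chart_map c x \<in> V \<and> V \<subseteq> chart_map c ` chart_dom c \<and>
      (\<forall>i<k. smooth_on (V \<times> ?F) (Z i)) \<and>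
      (\<forall>\<sigma>\<in>Sym_plus A. fst \<sigma> \<in> chart_dom c \<and> chart_map c (fst \<sigma>) \<in> V \<longrightarrow>
         inj_on (\<lambda>i. Z i (chart_map (tensors.lift_chart c) \<sigma>)) {..<k} \<and>
         independent ((\<lambda>i. Z i (chart_map (tensors.lift_chart c) \<sigma>)) ` {..<k}) \<and>
         span ((\<lambda>i. Z i (chart_map (tensors.lift_chart c) \<sigma>)) ` {..<k}) =
           chart_fibre HS (tensors.lift_chart c) \<sigma>)"
    using open_V by (intro exI[of _ V] exI[of _ k] exI[of _ Z]) simp
qed

end

theorem proposition2p1:
  fixes A :: "('a, real ^ 'n::finite) chart set"
    and H :: "(('a, 'n) frame \<times> (('a, 'n) frame, (real ^ 'n) \<times> (real ^ 'n ^ 'n)) tangent) set"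
  assumes "smooth_manifold A"
    and "connected_space (atlas_topology A)"
    and "compact_space (atlas_topology A)"
    and "frame_bundle_connection A H"
  shows "\<exists>HS. smooth_splitting (Sym_plus_atlas A) HS (kernel_bundle (Sym_plus_atlas A) A fst) \<and>
           tangent_map (frame_bundle_atlas A) (Sym_plus_atlas A) (Sigma_map A) ` H = HS \<and>
           (\<forall>\<sigma>\<in>Sym_plus A. \<forall>v\<in>tangent_space A (fst \<sigma>).
              \<exists>!h. h \<in> HS `` {\<sigma>} \<and>
                   tangent_map (Sym_plus_atlas A) A fst (\<sigma>, h) = (fst \<sigma>, v))"
proof -
  interpret frame_connection A H
    using assms(1,4) by (simp add: frame_connection_def smooth_manifold_def)
  have "\<exists>!h. h \<in> HS `` {\<sigma>} \<and> tangent_map tensors.lift_atlas A fst (\<sigma>, h) = (fst \<sigma>, v)"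
    if \<sigma>: "\<sigma> \<in> Sym_plus A" and v: "v \<in> tangent_space A (fst \<sigma>)" for \<sigma> v
  proof -
    obtain c where c: "c \<in> charts_at A (fst \<sigma>)" using tensors.chart_exists[OF \<sigma>] .
    show ?thesis by (rule tensors.unique_lift[OF HS_subset \<sigma> c bij_chart_fibre_HS[OF \<sigma> c] v])
  qed
  \<comment> \<open>With the image of \<open>H\<close> as witness the push forward clause is
    immediate, and the splitting reduces to smoothness of \<open>HS\<close> and bijectivity of
    \<open>fst\<close> on its chart fibres.\<close>
  then show ?thesis
    unfolding Sym_plus_atlas_eq frame_bundle_atlas_eq
    by (intro exI[of _ HS] conjI tensors.splittingI smooth_subbundle_HS bij_chart_fibre_HS)
      (auto simp: HS_def)
qed

end
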